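(* Let $A=[c,d]\subset\mathbb R$ and let $V_i(t),W_i(t)$, $t\in A$, $1\le i\le n$, be independent centered Gaussian processes with a.s. continuous sample paths. If for all $1\le i\le n$ $$\mathbb{E}(V_i^2(t))=\mathbb{E}(W_i^2(t)),\ t\in A,\qquad\text{and}\qquad \mathbb{E}(V_i(s)V_i(t))\ge\mathbb{E}(W_i(s)W_i(t)),\ s,t\in A,$$ then, for all $u>0$, $$\mathbb{P}\left(\sup_{t\in A}\sum_{i=1}^nV_i^2(t)>u\right)\le2^n\,\mathbb{P}\left(\sup_{t\in A}\sum_{i=1}^nW_i^2(t)>u\right).$$ *)

theory Defs
  imports "HOL-Probability.Probability"
begin

text \<open>A real Gaussian random variable; almost surely constant variables are included
  (variance zero), as is needed for processes with degenerate covariance.\<close>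

definition gaussian_rv :: "'a measure \<Rightarrow> ('a \<Rightarrow> real) \<Rightarrow> bool" where
  "gaussian_rv M X \<longleftrightarrow> X \<in> borel_measurable M \<and>
     (\<exists>\<mu>. (AE \<omega> in M. X \<omega> = \<mu>) \<or>
          (\<exists>\<sigma>>0. distributed M lborel X (normal_density \<mu> \<sigma>)))"

definition gaussian_process :: "'a measure \<Rightarrow> 't set \<Rightarrow> ('t \<Rightarrow> 'a \<Rightarrow> real) \<Rightarrow> bool" where
  "gaussian_process M T X \<longleftrightarrow>
     (\<forall>F a. finite F \<longrightarrow> F \<subseteq> T \<longrightarrow> gaussian_rv M (\<lambda>\<omega>. \<Sum>t\<in>F. a t * X t \<omega>))"

definition centered_gaussian_process :: "'a measure \<Rightarrow> 't set \<Rightarrow> ('t \<Rightarrow> 'a \<Rightarrow> real) \<Rightarrow> bool" where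
  "centered_gaussian_process M T X \<longleftrightarrow>
     gaussian_process M T X \<and> (\<forall>t\<in>T. (\<integral>\<omega>. X t \<omega> \<partial>M) = 0)"

definition continuous_paths_ae ::
    "'a measure \<Rightarrow> 't::topological_space set \<Rightarrow> ('t \<Rightarrow> 'a \<Rightarrow> real) \<Rightarrow> bool" where
  "continuous_paths_ae M T X \<longleftrightarrow> (AE \<omega> in M. continuous_on T (\<lambda>t. X t \<omega>))"

text \<open>Mutual independence of a family of processes, each regarded as a single random element
  of the product space of real functions on \<open>T\<close>; equivalently, of the \<sigma>-algebras generated
  by the processes.\<close>

definition indep_processes ::
    "'a measure \<Rightarrow> 't set \<Rightarrow> ('i \<Rightarrow> 't \<Rightarrow> 'a \<Rightarrow> real) \<Rightarrow> 'i set \<Rightarrow> bool" where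
  "indep_processes M T X I \<longleftrightarrow>
     prob_space.indep_vars M (\<lambda>_. Pi\<^sub>M T (\<lambda>_. borel)) (\<lambda>i \<omega>. \<lambda>t\<in>T. X i t \<omega>) I"

text \<open>The supremum is taken in the extended reals, since it may be infinite on the null set of
  discontinuous paths. For the same reason the event need not belong to \<open>sets M\<close>, but it differs
  from a measurable event by a subset of a null set, so its probability is taken with respect to
  the completion of \<open>M\<close> (which agrees with \<open>M\<close> on \<open>sets M\<close>).\<close>

definition sup_exceed_prob ::
    "'a measure \<Rightarrow> 't set \<Rightarrow> ('t \<Rightarrow> 'a \<Rightarrow> real) \<Rightarrow> real \<Rightarrow> real" where
  "sup_exceed_prob M T Z u =
     measure (completion M) {\<omega> \<in> space M. (SUP t\<in>T. ereal (Z t \<omega>)) > ereal u}"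

end

theory Submission
  imports Defs "HOL-Real_Asymp.Real_Asymp"
begin

text \<open>The processes \<open>V\<^sub>1, \<dots>, V\<^sub>n\<close> are replaced by \<open>W\<^sub>1, \<dots>, W\<^sub>n\<close> one at a time. Conditionally on
  the other summands, \<open>V\<^sub>i\<^sup>2 + r > u\<close> says that \<open>V\<^sub>i\<close> or \<open>- V\<^sub>i\<close> crosses the barrier \<open>sqrt (u - r)\<close>, so
  Slepian's inequality with a non-constant barrier, applied to both signs, costs a factor 2 per step.

  Slepian's inequality for finitely many times is proved by the interpolation
  \<open>X = cos \<theta> V + sin \<theta> W\<close> with \<open>Y = dX/d\<theta>\<close>. The equal variances make \<open>Y\<^sub>i\<close> and \<open>X\<^sub>i\<close> uncorrelated, and
  the covariance inequality gives \<open>E (Y\<^sub>i X\<^sub>k) \<le> 0\<close>. Writing \<open>X\<^sub>k = R\<^sub>k + \<kappa>\<^sub>k Y\<^sub>i\<close> with \<open>\<kappa>\<^sub>k \<le> 0\<close> and \<open>R\<close>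
  independent of \<open>Y\<^sub>i\<close>, the partial derivative \<open>\<partial>\<^sub>i F(X)\<close> of a product \<open>F\<close> of decreasing functions is, for
  fixed \<open>R\<close>, a decreasing function of \<open>Y\<^sub>i\<close>. Its product with \<open>Y\<^sub>i\<close> therefore has nonpositive expectation;
  no density and no Gaussian integration by parts is needed.\<close>

subsection \<open>Vanishing Fourier transforms\<close>

lemma borel_measurable_cnj[measurable]: "cnj \<in> borel_measurable borel"
  by (intro borel_measurable_continuous_onI continuous_intros)

lemma integrable_scaleR_bounded:
  fixes f :: "_ \<Rightarrow> real" and g :: "_ \<Rightarrow> 'b::{banach, second_countable_topology}"
  assumes f: "integrable M f" and [measurable]: "g \<in> borel_measurable M"
    and bnd: "\<And>x. norm (g x) \<le> B"
  shows "integrable M (\<lambda>x. f x *\<^sub>R g x)"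
proof (rule Bochner_Integration.integrable_bound)
  have [measurable]: "f \<in> borel_measurable M" using f by auto
  show "integrable M (\<lambda>x. f x * B)" using f by simp
  show "(\<lambda>x. f x *\<^sub>R g x) \<in> borel_measurable M" by measurable
  show "AE x in M. norm (f x *\<^sub>R g x) \<le> norm (f x * B)"
    using order_trans[OF bnd abs_ge_self] by (auto simp: abs_mult intro!: mult_left_mono)
qed

lemma integrable_mult_bounded:
  fixes f :: "_ \<Rightarrow> 'b::{real_normed_algebra, banach, second_countable_topology}"
  assumes f: "integrable M f" and [measurable]: "g \<in> borel_measurable M"
    and bnd: "\<And>x. norm (g x) \<le> B"
  shows "integrable M (\<lambda>x. f x * g x)"
proof (rule Bochner_Integration.integrable_bound)
  have [measurable]: "f \<in> borel_measurable M" using f by auto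
  show "integrable M (\<lambda>x. B *\<^sub>R f x)" using f by simp
  show "(\<lambda>x. f x * g x) \<in> borel_measurable M" by measurable
  show "AE x in M. norm (f x * g x) \<le> norm (B *\<^sub>R f x)"
  proof (rule AE_I2)
    fix x
    have "norm (f x * g x) \<le> norm (f x) * \<bar>B\<bar>"
      using order_trans[OF bnd abs_ge_self]
      by (intro order_trans[OF norm_mult_ineq] mult_left_mono) auto
    then show "norm (f x * g x) \<le> norm (B *\<^sub>R f x)"
      by (simp add: mult.commute)
  qed
qed

text \<open>The positive and negative parts of \<open>Z\<close>, used as densities and pushed
  forward along \<open>X\<close>, give two finite measures on the line whose Fourier transforms
  differ by the transform in the hypothesis, hence coincide. After normalisation Levy's uniqueness
  theorem identifies them, and \<open>h\<close> is then integrated against one and the same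
  law.\<close>

lemma (in prob_space) integral_mult_eq_0_if_fourier_eq_0_real:
  fixes Z X h :: "_ \<Rightarrow> real"
  assumes Z: "integrable M Z" and X[measurable]: "X \<in> borel_measurable M"
    and fourier: "\<And>t. (CLINT \<omega>|M. Z \<omega> * iexp (t * X \<omega>)) = 0"
    and h[measurable]: "h \<in> borel_measurable borel" and bnd: "\<And>x. \<bar>h x\<bar> \<le> B"
  shows "(\<integral>\<omega>. Z \<omega> * h (X \<omega>) \<partial>M) = 0"
proof -
  have [measurable]: "Z \<in> borel_measurable M" using Z by auto
  define P where "P = (\<lambda>\<omega>. max 0 (Z \<omega>))"
  define N where "N = (\<lambda>\<omega>. max 0 (- Z \<omega>))"
  have PN: "Z \<omega> = P \<omega> - N \<omega>" for \<omega> by (auto simp: P_def N_def)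
  have P0: "P \<omega> \<ge> 0" and N0: "N \<omega> \<ge> 0" for \<omega> by (auto simp: P_def N_def)
  have iP: "integrable M P" and iN: "integrable M N"
    unfolding P_def N_def using Z by auto
  define m where "m = integral\<^sup>L M P"
  \<comment> \<open>Frequency 0 shows that both parts have the same mass \<open>m\<close>, so a
    single constant normalises both.\<close>
  have "complex_of_real (integral\<^sup>L M Z) = 0"
    using fourier[of 0] by simp
  then have "integral\<^sup>L M Z = 0" by simp
  then have mN: "m = integral\<^sup>L M N"
    unfolding m_def PN using iP iN by simp
  have m0: "m \<ge> 0" unfolding m_def using P0 by simp
  show ?thesis
  proof (cases "m = 0")
    \<comment> \<open>Mass 0 cannot be normalised to a probability, but then both parts vanish
      almost everywhere and so does \<open>Z\<close>.\<close>
    case True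
    have "AE \<omega> in M. P \<omega> = 0"
      using integral_nonneg_eq_0_iff_AE[OF iP] P0 True by (simp add: m_def)
    moreover have "AE \<omega> in M. N \<omega> = 0"
      using integral_nonneg_eq_0_iff_AE[OF iN] N0 True by (simp add: mN)
    ultimately have "AE \<omega> in M. Z \<omega> * h (X \<omega>) = 0"
      by eventually_elim (simp add: PN)
    then show ?thesis
      by (rule integral_eq_zero_AE)
  next
    case False
    then have mp: "m > 0" using m0 by simp
    \<comment> \<open>\<open>\<mu> f\<close> is the law of \<open>X\<close> after reweighting
      \<open>M\<close> by \<open>f / m\<close>.\<close>
    define \<mu> where "\<mu> f = distr (density M (\<lambda>\<omega>. ennreal (f \<omega> / m))) borel X" for f :: "'a \<Rightarrow> real"
    have distr: "real_distribution (\<mu> f)"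
      if f: "integrable M f" and f0: "\<And>\<omega>. f \<omega> \<ge> 0" and fm: "integral\<^sup>L M f = m" for f
    proof -
      have [measurable]: "f \<in> borel_measurable M" using f by auto
      have "(\<integral>\<^sup>+\<omega>. ennreal (f \<omega> / m) \<partial>M) = ennreal (\<integral>\<omega>. f \<omega> / m \<partial>M)"
        using f f0 mp by (intro nn_integral_eq_integral) auto
      also have "\<dots> = 1" using fm mp by simp
      finally have "emeasure (density M (\<lambda>\<omega>. ennreal (f \<omega> / m))) (space M) = 1"
        by (subst emeasure_density) (auto intro!: nn_integral_cong simp: indicator_def cong: nn_integral_cong)
      then have "prob_space (density M (\<lambda>\<omega>. ennreal (f \<omega> / m)))"
        by (intro prob_spaceI) simp
      then have "prob_space (\<mu> f)"
        unfolding \<mu>_def by (rule prob_space.prob_space_distr) simp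
      then show ?thesis
        unfolding real_distribution_def real_distribution_axioms_def by (simp add: \<mu>_def)
    qed
    have integ: "(\<integral>x. g x \<partial>\<mu> f) = (\<integral>\<omega>. f \<omega> *\<^sub>R g (X \<omega>) \<partial>M) /\<^sub>R m"
      if f: "integrable M f" and f0: "\<And>\<omega>. f \<omega> \<ge> 0" and g[measurable]: "g \<in> borel_measurable borel"
      for f and g :: "real \<Rightarrow> 'b::{banach, second_countable_topology}"
    proof -
      have [measurable]: "f \<in> borel_measurable M" using f by auto
      have "(\<integral>x. g x \<partial>\<mu> f) = (\<integral>\<omega>. g (X \<omega>) \<partial>density M (\<lambda>\<omega>. ennreal (f \<omega> / m)))"
        unfolding \<mu>_def by (rule integral_distr) auto
      also have "\<dots> = (\<integral>\<omega>. (f \<omega> / m) *\<^sub>R g (X \<omega>) \<partial>M)"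
        using f0 mp by (intro integral_density) auto
      also have "\<dots> = (\<integral>\<omega>. inverse m *\<^sub>R (f \<omega> *\<^sub>R g (X \<omega>)) \<partial>M)"
        by (simp add: divide_inverse mult.commute)
      finally show ?thesis by (simp only: integral_scaleR_right)
    qed
    have "char (\<mu> P) = char (\<mu> N)"
    proof
      fix t
      have iexp: "(\<lambda>x. iexp (t * x)) \<in> borel_measurable borel"
        by measurable
      have "(CLINT \<omega>|M. P \<omega> *\<^sub>R iexp (t * X \<omega>)) - (CLINT \<omega>|M. N \<omega> *\<^sub>R iexp (t * X \<omega>))
          = (CLINT \<omega>|M. P \<omega> *\<^sub>R iexp (t * X \<omega>) - N \<omega> *\<^sub>R iexp (t * X \<omega>))"
        by (intro Bochner_Integration.integral_diff[symmetric] integrable_scaleR_bounded[where B=1] iP iN) auto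
      also have "\<dots> = 0"
        using fourier[of t] by (simp add: PN scaleR_conv_of_real algebra_simps)
      finally show "char (\<mu> P) t = char (\<mu> N) t"
        unfolding char_def integ[OF iP P0 iexp] integ[OF iN N0 iexp] by simp
    qed
    then have "\<mu> P = \<mu> N"
      using distr[OF iP P0 m_def[symmetric]] distr[OF iN N0 mN[symmetric]] Levy_uniqueness by blast
    then have "(\<integral>\<omega>. P \<omega> *\<^sub>R h (X \<omega>) \<partial>M) = (\<integral>\<omega>. N \<omega> *\<^sub>R h (X \<omega>) \<partial>M)"
      using integ[OF iP P0 h] integ[OF iN N0 h] mp by simp
    then have "(\<integral>\<omega>. P \<omega> *\<^sub>R h (X \<omega>) - N \<omega> *\<^sub>R h (X \<omega>) \<partial>M) = 0"
      using Bochner_Integration.integral_diff[OF integrable_scaleR_bounded[OF iP, of "\<lambda>\<omega>. h (X \<omega>)" B]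
          integrable_scaleR_bounded[OF iN, of "\<lambda>\<omega>. h (X \<omega>)" B]] bnd by simp
    then show ?thesis
      by (simp add: PN algebra_simps)
  qed
qed

text \<open>The transform of \<open>cnj Z\<close> at t is the conjugate of that of \<open>Z\<close>
  at -t, so it vanishes as well. Real and imaginary part of \<open>Z\<close> are combinations of
  \<open>Z\<close> and \<open>cnj Z\<close>, which reduces the claim to real weights. Complex
  weights are wanted because the induction of the next lemma multiplies the weight by
  exponentials.\<close>

lemma (in prob_space) integral_mult_eq_0_if_fourier_eq_0:
  fixes Z :: "_ \<Rightarrow> complex" and X h :: "_ \<Rightarrow> real"
  assumes Z: "integrable M Z" and X[measurable]: "X \<in> borel_measurable M"
    and fourier: "\<And>t. (CLINT \<omega>|M. Z \<omega> * iexp (t * X \<omega>)) = 0"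
    and h[measurable]: "h \<in> borel_measurable borel" and bnd: "\<And>x. \<bar>h x\<bar> \<le> B"
  shows "(CLINT \<omega>|M. Z \<omega> * h (X \<omega>)) = 0"
proof -
  have [measurable]: "Z \<in> borel_measurable M" using Z by auto
  have int: "integrable M (\<lambda>\<omega>. Z \<omega> * iexp (t * X \<omega>))" for t
    by (rule Bochner_Integration.integrable_bound[OF Z]) (auto simp: norm_mult)
  have fourier': "(CLINT \<omega>|M. cnj (Z \<omega>) * iexp (t * X \<omega>)) = 0" for t
  proof -
    have "(CLINT \<omega>|M. cnj (Z \<omega>) * iexp (t * X \<omega>)) = (CLINT \<omega>|M. cnj (Z \<omega> * iexp (- t * X \<omega>)))"
      by (rule Bochner_Integration.integral_cong) (auto simp: exp_cnj)
    also have "\<dots> = 0"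
      unfolding Bochner_Integration.integral_cnj fourier by simp
    finally show ?thesis .
  qed
  have int': "integrable M (\<lambda>\<omega>. cnj (Z \<omega>) * iexp (t * X \<omega>))" for t
    by (rule Bochner_Integration.integrable_bound[OF Z]) (auto simp: norm_mult)
  have re: "(\<integral>\<omega>. Re (Z \<omega>) * h (X \<omega>) \<partial>M) = 0"
  proof (rule integral_mult_eq_0_if_fourier_eq_0_real[OF _ X _ h bnd])
    fix t
    have "(CLINT \<omega>|M. Re (Z \<omega>) * iexp (t * X \<omega>))
        = (CLINT \<omega>|M. (Z \<omega> * iexp (t * X \<omega>) + cnj (Z \<omega>) * iexp (t * X \<omega>)) / 2)"
      by (rule Bochner_Integration.integral_cong) (auto simp: complex_add_cnj simp flip: distrib_right)
    also have "\<dots> = 0"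
      using int int' fourier fourier' by simp
    finally show "(CLINT \<omega>|M. Re (Z \<omega>) * iexp (t * X \<omega>)) = 0" .
  qed (use Z in auto)
  have im: "(\<integral>\<omega>. Im (Z \<omega>) * h (X \<omega>) \<partial>M) = 0"
  proof (rule integral_mult_eq_0_if_fourier_eq_0_real[OF _ X _ h bnd])
    fix t
    have "(CLINT \<omega>|M. Im (Z \<omega>) * iexp (t * X \<omega>))
        = (CLINT \<omega>|M. (Z \<omega> * iexp (t * X \<omega>) - cnj (Z \<omega>) * iexp (t * X \<omega>)) / (2 * \<i>))"
      by (rule Bochner_Integration.integral_cong) (auto simp: complex_diff_cnj field_simps simp flip: left_diff_distrib)
    also have "\<dots> = 0"
      using int int' fourier fourier' by simp
    finally show "(CLINT \<omega>|M. Im (Z \<omega>) * iexp (t * X \<omega>)) = 0" .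
  qed (use Z in auto)
  have int_h: "integrable M (\<lambda>\<omega>. Z \<omega> * h (X \<omega>))"
    using bnd by (intro integrable_mult_bounded[OF Z, where B=B]) auto
  show ?thesis
    by (rule complex_eqI) (use re im int_h in \<open>simp_all flip: integral_Re integral_Im\<close>)
qed

text \<open>Exponentials are exchanged for bounded functions one coordinate at a time, so that
  uniqueness on the line suffices even though the transform is multivariate. The weight varies in
  the induction: it takes up the factor \<open>h k (X k)\<close> of the coordinate just
  treated.\<close>

lemma (in prob_space) integral_mult_prod_eq_0_if_fourier_eq_0:
  fixes Z :: "_ \<Rightarrow> complex" and X :: "'j \<Rightarrow> _ \<Rightarrow> real" and h :: "'j \<Rightarrow> real \<Rightarrow> real"
  assumes "finite J" and "integrable M Z" and "\<And>j. j \<in> J \<Longrightarrow> X j \<in> borel_measurable M"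
    and "\<And>a. (CLINT \<omega>|M. Z \<omega> * iexp (\<Sum>j\<in>J. a j * X j \<omega>)) = 0"
    and "\<And>j. j \<in> J \<Longrightarrow> h j \<in> borel_measurable borel" and "\<And>j x. j \<in> J \<Longrightarrow> \<bar>h j x\<bar> \<le> B"
  shows "(CLINT \<omega>|M. Z \<omega> * (\<Prod>j\<in>J. h j (X j \<omega>))) = 0"
  using assms
proof (induction J arbitrary: Z rule: finite_induct)
  case empty
  then show ?case by simp
next
  case (insert k J)
  note Z = insert.prems(1) and fourier = insert.prems(3)
  have X[measurable]: "X j \<in> borel_measurable M" "h j \<in> borel_measurable borel" if "j \<in> insert k J" for j
    using insert.prems that by auto
  have Xk[measurable]: "X k \<in> borel_measurable M" "h k \<in> borel_measurable borel"
    using X by auto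
  have [measurable]: "Z \<in> borel_measurable M" using Z by auto
  have "\<bar>h k x\<bar> \<le> \<bar>B\<bar>" for x
    by (rule order_trans[OF insert.prems(5) abs_ge_self]) simp
  then have int_h: "integrable M (\<lambda>\<omega>. Z \<omega> * h k (X k \<omega>))"
    by (intro integrable_mult_bounded[OF Z]) auto
  have "(CLINT \<omega>|M. Z \<omega> * h k (X k \<omega>) * (\<Prod>j\<in>J. h j (X j \<omega>))) = 0"
  proof (rule insert.IH[OF int_h])
    fix a
    \<comment> \<open>With the frequencies of the other coordinates frozen, their exponential
      becomes part of the weight and only the frequency t of \<open>X k\<close> remains free. The
      joint hypothesis is used at \<open>a(k := t)\<close>.\<close>
    let ?Y = "\<lambda>\<omega>. Z \<omega> * iexp (\<Sum>j\<in>J. a j * X j \<omega>)"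
    have [measurable]: "(\<lambda>\<omega>. \<Sum>j\<in>J. a j * X j \<omega>) \<in> borel_measurable M"
      using X by (intro borel_measurable_sum borel_measurable_times) auto
    have "(CLINT \<omega>|M. ?Y \<omega> * h k (X k \<omega>)) = 0"
    proof (rule integral_mult_eq_0_if_fourier_eq_0[where Z="?Y" and X="X k" and h="h k" and B=B])
      show "integrable M ?Y"
        by (rule Bochner_Integration.integrable_bound[OF Z]) (auto simp: norm_mult)
      fix t
      have "(CLINT \<omega>|M. ?Y \<omega> * iexp (t * X k \<omega>))
          = (CLINT \<omega>|M. Z \<omega> * iexp (\<Sum>j\<in>insert k J. (a(k := t)) j * X j \<omega>))"
      proof (rule Bochner_Integration.integral_cong[OF refl])
        fix \<omega>
        have "(\<Sum>j\<in>insert k J. (a(k := t)) j * X j \<omega>) = t * X k \<omega> + (\<Sum>j\<in>J. a j * X j \<omega>)"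
          using insert.hyps by (auto intro!: sum.cong)
        then show "?Y \<omega> * iexp (t * X k \<omega>) = Z \<omega> * iexp (\<Sum>j\<in>insert k J. (a(k := t)) j * X j \<omega>)"
          by (simp add: exp_add distrib_left)
      qed
      then show "(CLINT \<omega>|M. ?Y \<omega> * iexp (t * X k \<omega>)) = 0"
        using fourier by simp
    qed (use insert.prems(5) in auto)
    then show "(CLINT \<omega>|M. Z \<omega> * h k (X k \<omega>) * iexp (\<Sum>j\<in>J. a j * X j \<omega>)) = 0"
      by (simp add: mult_ac)
  qed (use X insert.prems(5) in auto)
  then show ?case
    using insert.hyps by (simp add: mult_ac)
qed

subsection \<open>Gaussian spaces\<close>

lemma (in prob_space) gaussian_rv_integrable:
  assumes "gaussian_rv M X"
  shows "integrable M X" "integrable M (\<lambda>\<omega>. (X \<omega>)\<^sup>2)"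
proof -
  have [measurable]: "X \<in> borel_measurable M"
    using assms by (simp add: gaussian_rv_def)
  consider \<mu> where "AE \<omega> in M. X \<omega> = \<mu>"
    | \<mu> \<sigma> where "\<sigma> > 0" "distributed M lborel X (normal_density \<mu> \<sigma>)"
    using assms unfolding gaussian_rv_def by blast
  then have "integrable M X \<and> integrable M (\<lambda>\<omega>. (X \<omega>)\<^sup>2)"
  proof cases
    case 1
    have "integrable M X \<longleftrightarrow> integrable M (\<lambda>_. \<mu>)"
      using 1 by (intro integrable_cong_AE) auto
    moreover have "integrable M (\<lambda>\<omega>. (X \<omega>)\<^sup>2) \<longleftrightarrow> integrable M (\<lambda>_. \<mu>\<^sup>2)"
      using 1 by (intro integrable_cong_AE) auto
    ultimately show ?thesis by simp
  next
    case 2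
    have X: "integrable M X"
      using distributed_integrable[OF 2(2), of "\<lambda>x. x"] integrable_normal_moment_nz_1[OF 2(1), of \<mu>] by simp
    have "integrable M (\<lambda>\<omega>. (X \<omega> - \<mu>)\<^sup>2)"
      using distributed_integrable[OF 2(2), of "\<lambda>x. (x - \<mu>)\<^sup>2"] integrable_normal_moment[OF 2(1), of \<mu> 2] by simp
    then have "integrable M (\<lambda>\<omega>. (X \<omega> - \<mu>)\<^sup>2 + 2 * \<mu> * X \<omega> - \<mu>\<^sup>2)"
      using X by simp
    then show ?thesis using X by (simp add: power2_eq_square algebra_simps)
  qed
  then show "integrable M X" "integrable M (\<lambda>\<omega>. (X \<omega>)\<^sup>2)" by auto
qed

text \<open>In the degenerate case centering forces the constant to be 0, and both sides are 1.
  Otherwise \<open>X / \<sigma>\<close> is standard normal, and its characteristic function is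
  evaluated at the point \<open>\<sigma>\<close>.\<close>

lemma (in prob_space) gaussian_rv_iexp:
  assumes X: "gaussian_rv M X" and mean: "expectation X = 0"
  shows "(CLINT \<omega>|M. iexp (X \<omega>)) = exp (- complex_of_real (\<integral>\<omega>. (X \<omega>)\<^sup>2 \<partial>M) / 2)"
proof -
  have [measurable]: "X \<in> borel_measurable M"
    using X by (simp add: gaussian_rv_def)
  consider \<mu> where "AE \<omega> in M. X \<omega> = \<mu>"
    | \<mu> \<sigma> where "\<sigma> > 0" "distributed M lborel X (normal_density \<mu> \<sigma>)"
    using X unfolding gaussian_rv_def by blast
  then show ?thesis
  proof cases
    case 1
    then have "expectation X = expectation (\<lambda>_. \<mu>)"
      by (intro integral_cong_AE) auto
    then have 0: "AE \<omega> in M. X \<omega> = 0"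
      using 1 mean by (simp add: prob_space)
    have "(CLINT \<omega>|M. iexp (X \<omega>)) = (CLINT \<omega>|M. 1)"
      using 0 by (intro integral_cong_AE) auto
    moreover have "(\<integral>\<omega>. (X \<omega>)\<^sup>2 \<partial>M) = (\<integral>\<omega>. 0 \<partial>M)"
      using 0 by (intro integral_cong_AE) auto
    ultimately show ?thesis by (simp add: prob_space)
  next
    case 2
    have \<mu>: "\<mu> = 0"
      using normal_distributed_expectation[OF 2] mean by simp
    have var: "(\<integral>\<omega>. (X \<omega>)\<^sup>2 \<partial>M) = \<sigma>\<^sup>2"
      using normal_distributed_variance[OF 2] mean by simp
    have "distributed M lborel (\<lambda>\<omega>. X \<omega> / \<sigma>) std_normal_density"
      using 2 normal_standard_normal_convert[OF 2(1), of X \<mu>] by (simp add: \<mu>)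
    then have "distr M lborel (\<lambda>\<omega>. X \<omega> / \<sigma>) = std_normal_distribution"
      by (simp add: distributed_def)
    moreover have "distr M lborel (\<lambda>\<omega>. X \<omega> / \<sigma>) = distr M borel (\<lambda>\<omega>. X \<omega> / \<sigma>)"
      by (rule distr_cong) auto
    ultimately have "char (distr M borel (\<lambda>\<omega>. X \<omega> / \<sigma>)) \<sigma> = complex_of_real (exp (- (\<sigma>\<^sup>2) / 2))"
      by (simp add: char_std_normal_distribution)
    moreover have "char (distr M borel (\<lambda>\<omega>. X \<omega> / \<sigma>)) \<sigma> = (CLINT \<omega>|M. iexp (\<sigma> * (X \<omega> / \<sigma>)))"
      unfolding char_def by (rule integral_distr) measurable
    ultimately show ?thesis
      using 2(1) by (simp add: var exp_of_real[symmetric])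
  qed
qed

text \<open>Closure under linear combinations makes the one-dimensional characteristic functions determine
  all finite-dimensional distributions, so no multivariate normal law is needed.\<close>

definition gaussian_space :: "'a measure \<Rightarrow> ('a \<Rightarrow> real) set \<Rightarrow> bool" where
  "gaussian_space M S \<longleftrightarrow>
     (\<forall>L\<in>S. L \<in> borel_measurable M \<and> integrable M (\<lambda>\<omega>. (L \<omega>)\<^sup>2) \<and>
        (CLINT \<omega>|M. iexp (L \<omega>)) = exp (- complex_of_real (\<integral>\<omega>. (L \<omega>)\<^sup>2 \<partial>M) / 2)) \<and>
     (\<lambda>_. 0) \<in> S \<and> (\<forall>L\<in>S. \<forall>K\<in>S. \<forall>a b. (\<lambda>\<omega>. a * L \<omega> + b * K \<omega>) \<in> S)"

lemma gaussian_spaceD: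
  assumes "gaussian_space M S"
  shows "L \<in> S \<Longrightarrow> L \<in> borel_measurable M"
    and "L \<in> S \<Longrightarrow> integrable M (\<lambda>\<omega>. (L \<omega>)\<^sup>2)"
    and "L \<in> S \<Longrightarrow> (CLINT \<omega>|M. iexp (L \<omega>)) = exp (- complex_of_real (\<integral>\<omega>. (L \<omega>)\<^sup>2 \<partial>M) / 2)"
    and "(\<lambda>_. 0) \<in> S"
    and "L \<in> S \<Longrightarrow> K \<in> S \<Longrightarrow> (\<lambda>\<omega>. a * L \<omega> + b * K \<omega>) \<in> S"
  using assms unfolding gaussian_space_def by blast+

lemma integrable_mult_square_integrable:
  fixes f g :: "_ \<Rightarrow> real"
  assumes [measurable]: "f \<in> borel_measurable M" "g \<in> borel_measurable M"
    and "integrable M (\<lambda>x. (f x)\<^sup>2)" "integrable M (\<lambda>x. (g x)\<^sup>2)"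
  shows "integrable M (\<lambda>x. f x * g x)"
proof (rule Bochner_Integration.integrable_bound)
  show "integrable M (\<lambda>x. (f x)\<^sup>2 + (g x)\<^sup>2)" using assms by simp
  show "AE x in M. norm (f x * g x) \<le> norm ((f x)\<^sup>2 + (g x)\<^sup>2)"
  proof (rule AE_I2)
    fix x
    have "2 * (\<bar>f x\<bar> * \<bar>g x\<bar>) \<le> (f x)\<^sup>2 + (g x)\<^sup>2"
      using sum_squares_bound[of "\<bar>f x\<bar>" "\<bar>g x\<bar>"] by simp
    moreover have "\<bar>f x\<bar> * \<bar>g x\<bar> \<ge> 0" by simp
    ultimately have "\<bar>f x * g x\<bar> \<le> (f x)\<^sup>2 + (g x)\<^sup>2"
      unfolding abs_mult by linarith
    then show "norm (f x * g x) \<le> norm ((f x)\<^sup>2 + (g x)\<^sup>2)"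
      by simp
  qed
qed measurable

lemma gaussian_space_sum:
  assumes S: "gaussian_space M S" and "finite J" and "\<And>j. j \<in> J \<Longrightarrow> R j \<in> S"
  shows "(\<lambda>\<omega>. \<Sum>j\<in>J. a j * R j \<omega>) \<in> S"
  using assms(2,3)
proof (induction J rule: finite_induct)
  case empty
  then show ?case using gaussian_spaceD(4)[OF S] by simp
next
  case (insert k J)
  then have "(\<lambda>\<omega>. a k * R k \<omega> + 1 * (\<Sum>j\<in>J. a j * R j \<omega>)) \<in> S"
    by (intro gaussian_spaceD(5)[OF S]) auto
  then show ?case using insert.hyps by simp
qed

text \<open>The cross term of the second moment drops out. What matters later is that the right-hand
  side is even in \<open>s\<close>.\<close>

lemma (in prob_space) gaussian_space_iexp_uncorrelated:
  assumes S: "gaussian_space M S" and Y: "Y \<in> S" and L: "L \<in> S"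
    and uncorr: "(\<integral>\<omega>. Y \<omega> * L \<omega> \<partial>M) = 0"
  shows "(CLINT \<omega>|M. iexp (s * Y \<omega> + L \<omega>)) = exp (- complex_of_real (s\<^sup>2 * (\<integral>\<omega>. (Y \<omega>)\<^sup>2 \<partial>M) + (\<integral>\<omega>. (L \<omega>)\<^sup>2 \<partial>M)) / 2)"
proof -
  have [measurable]: "Y \<in> borel_measurable M" "L \<in> borel_measurable M"
    and int: "integrable M (\<lambda>\<omega>. (Y \<omega>)\<^sup>2)" "integrable M (\<lambda>\<omega>. (L \<omega>)\<^sup>2)"
    using gaussian_spaceD(1,2)[OF S] Y L by auto
  have YL: "integrable M (\<lambda>\<omega>. Y \<omega> * L \<omega>)"
    using int by (intro integrable_mult_square_integrable) auto
  have "(\<lambda>\<omega>. s * Y \<omega> + L \<omega>) \<in> S"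
    using gaussian_spaceD(5)[OF S Y L, of s 1] by simp
  then have "(CLINT \<omega>|M. iexp (s * Y \<omega> + L \<omega>)) = exp (- complex_of_real (\<integral>\<omega>. (s * Y \<omega> + L \<omega>)\<^sup>2 \<partial>M) / 2)"
    by (rule gaussian_spaceD(3)[OF S])
  also have "(\<integral>\<omega>. (s * Y \<omega> + L \<omega>)\<^sup>2 \<partial>M) = (\<integral>\<omega>. s\<^sup>2 * (Y \<omega>)\<^sup>2 + 2 * s * (Y \<omega> * L \<omega>) + (L \<omega>)\<^sup>2 \<partial>M)"
    by (intro Bochner_Integration.integral_cong refl) (simp add: power2_eq_square algebra_simps)
  also have "\<dots> = s\<^sup>2 * (\<integral>\<omega>. (Y \<omega>)\<^sup>2 \<partial>M) + (\<integral>\<omega>. (L \<omega>)\<^sup>2 \<partial>M)"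
    using int YL uncorr by simp
  finally show ?thesis .
qed

text \<open>Since the expectation of \<open>iexp (s * Y + L)\<close> is even in \<open>s\<close>,
  its odd part, the expectation of \<open>sin (s * Y) * iexp L\<close> up to a constant, vanishes
  for every \<open>s\<close>. Rescaling with \<open>s = 1 / n\<close> recovers \<open>Y\<close> in
  place of the sine, which amounts to differentiating at \<open>s = 0\<close>.\<close>

lemma (in prob_space) gaussian_space_integral_mult_iexp_eq_0:
  assumes S: "gaussian_space M S" and Y: "Y \<in> S" and L: "L \<in> S"
    and uncorr: "(\<integral>\<omega>. Y \<omega> * L \<omega> \<partial>M) = 0"
  shows "(CLINT \<omega>|M. Y \<omega> * iexp (L \<omega>)) = 0"
proof -
  have [measurable]: "Y \<in> borel_measurable M" "L \<in> borel_measurable M"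
    and int: "integrable M (\<lambda>\<omega>. (Y \<omega>)\<^sup>2)"
    using gaussian_spaceD(1,2)[OF S] Y L by auto
  have iY: "integrable M Y"
    using int integrable_mult_square_integrable[of Y M "\<lambda>_. 1"] by simp
  have sin: "(CLINT \<omega>|M. sin (s * Y \<omega>) * iexp (L \<omega>)) = 0" for s
  proof -
    have int': "integrable M (\<lambda>\<omega>. iexp (r * Y \<omega> + L \<omega>))" for r
      by (rule integrable_const_bound[where B=1]) (simp_all del: of_real_add of_real_mult)
    have sin_iexp: "complex_of_real (sin x) = (iexp x - iexp (- x)) / (2 * \<i>)" for x
      unfolding sin_of_real[symmetric] sin_exp_eq by simp
    have iexp_add: "iexp (x + y) = iexp x * iexp y" for x y
      by (simp add: exp_add distrib_left)
    have "(CLINT \<omega>|M. sin (s * Y \<omega>) * iexp (L \<omega>))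
        = (CLINT \<omega>|M. (iexp (s * Y \<omega> + L \<omega>) - iexp ((- s) * Y \<omega> + L \<omega>)) / (2 * \<i>))"
      by (simp only: sin_iexp iexp_add mult_minus_left left_diff_distrib times_divide_eq_left)
    also have "\<dots> = 0"
      unfolding integral_divide_zero Bochner_Integration.integral_diff[OF int' int']
      by (simp only: gaussian_space_iexp_uncorrelated[OF S Y L uncorr] power2_minus) simp
    finally show ?thesis .
  qed
  \<comment> \<open>\<open>n sin (Y / n)\<close> tends to \<open>Y\<close> and is dominated by \<open>\<bar>Y\<bar>\<close>.\<close>
  have "(\<lambda>n. CLINT \<omega>|M. of_nat n * complex_of_real (sin (1 / of_nat n * Y \<omega>)) * iexp (L \<omega>))
      \<longlonglongrightarrow> (CLINT \<omega>|M. Y \<omega> * iexp (L \<omega>))"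
  proof (rule integral_dominated_convergence)
    show "integrable M (\<lambda>\<omega>. \<bar>Y \<omega>\<bar>)" using iY by simp
    show "AE \<omega> in M. (\<lambda>n. of_nat n * complex_of_real (sin (1 / of_nat n * Y \<omega>)) * iexp (L \<omega>))
        \<longlonglongrightarrow> Y \<omega> * iexp (L \<omega>)"
    proof (rule AE_I2)
      fix \<omega>
      have "(\<lambda>n. real n * sin (1 / real n * Y \<omega>)) \<longlonglongrightarrow> Y \<omega>"
        by real_asymp
      then have "(\<lambda>n. complex_of_real (real n * sin (1 / real n * Y \<omega>)) * iexp (L \<omega>))
          \<longlonglongrightarrow> complex_of_real (Y \<omega>) * iexp (L \<omega>)"
        by (intro tendsto_intros)
      then show "(\<lambda>n. of_nat n * complex_of_real (sin (1 / of_nat n * Y \<omega>)) * iexp (L \<omega>))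
        \<longlonglongrightarrow> Y \<omega> * iexp (L \<omega>)" by simp
    qed
    fix n :: nat
    show "AE \<omega> in M. norm (of_nat n * complex_of_real (sin (1 / of_nat n * Y \<omega>)) * iexp (L \<omega>)) \<le> \<bar>Y \<omega>\<bar>"
    proof (rule AE_I2)
      fix \<omega>
      have "real n * \<bar>sin (1 / real n * Y \<omega>)\<bar> \<le> real n * \<bar>1 / real n * Y \<omega>\<bar>"
        by (intro mult_left_mono abs_sin_x_le_abs_x) auto
      also have "\<dots> \<le> \<bar>Y \<omega>\<bar>"
        by (cases "n = 0") (auto simp: abs_mult)
      finally show "norm (of_nat n * complex_of_real (sin (1 / of_nat n * Y \<omega>)) * iexp (L \<omega>)) \<le> \<bar>Y \<omega>\<bar>"
        by (simp add: norm_mult)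
    qed
  qed measurable
  moreover have "(CLINT \<omega>|M. of_nat n * complex_of_real (sin (1 / of_nat n * Y \<omega>)) * iexp (L \<omega>)) = 0" for n :: nat
    unfolding mult.assoc integral_mult_right_zero sin by simp
  ultimately have "(\<lambda>n :: nat. 0) \<longlonglongrightarrow> (CLINT \<omega>|M. Y \<omega> * iexp (L \<omega>))"
    by (simp only:)
  then show ?thesis
    using LIMSEQ_unique[OF _ tendsto_const] by metis
qed

text \<open>This plays the role of "uncorrelated Gaussians are independent". Orthogonality of
  \<open>Y\<close> to every \<open>R j\<close> passes to linear combinations, so the Fourier
  transform of the weight \<open>Y\<close> in the variables \<open>R j\<close> is zero, and
  exponentials may be exchanged for bounded functions.\<close>

lemma (in prob_space) gaussian_space_integral_mult_prod_eq_0: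
  assumes S: "gaussian_space M S" and Y: "Y \<in> S" and J: "finite J"
    and R: "\<And>j. j \<in> J \<Longrightarrow> R j \<in> S"
    and uncorr: "\<And>j. j \<in> J \<Longrightarrow> (\<integral>\<omega>. Y \<omega> * R j \<omega> \<partial>M) = 0"
    and h: "\<And>j. j \<in> J \<Longrightarrow> h j \<in> borel_measurable borel"
    and bnd: "\<And>j x. j \<in> J \<Longrightarrow> \<bar>h j x\<bar> \<le> B"
  shows "(\<integral>\<omega>. Y \<omega> * (\<Prod>j\<in>J. h j (R j \<omega>)) \<partial>M) = 0"
proof -
  have meas: "L \<in> borel_measurable M" and sq: "integrable M (\<lambda>\<omega>. (L \<omega>)\<^sup>2)" if "L \<in> S" for L
    using gaussian_spaceD(1,2)[OF S] that by auto
  have iY: "integrable M Y"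
    using sq[OF Y] integrable_mult_square_integrable[of Y M "\<lambda>_. 1"] meas[OF Y] by simp
  have "(CLINT \<omega>|M. complex_of_real (Y \<omega>) * (\<Prod>j\<in>J. h j (R j \<omega>))) = 0"
  proof (rule integral_mult_prod_eq_0_if_fourier_eq_0[OF J _ _ _ h bnd])
    show "integrable M (\<lambda>\<omega>. complex_of_real (Y \<omega>))" using iY by simp
    show "R j \<in> borel_measurable M" if "j \<in> J" for j using R[OF that] meas by simp
    fix a
    have "integrable M (\<lambda>\<omega>. Y \<omega> * R j \<omega>)" if "j \<in> J" for j
      using that R Y meas sq by (intro integrable_mult_square_integrable) auto
    then have "(\<integral>\<omega>. (\<Sum>j\<in>J. a j * (Y \<omega> * R j \<omega>)) \<partial>M) = (\<Sum>j\<in>J. a j * (\<integral>\<omega>. Y \<omega> * R j \<omega> \<partial>M))"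
      by (subst Bochner_Integration.integral_sum) auto
    also have "\<dots> = 0"
      using uncorr by (intro sum.neutral) auto
    finally have "(\<integral>\<omega>. Y \<omega> * (\<Sum>j\<in>J. a j * R j \<omega>) \<partial>M) = 0"
      by (simp only: sum_distrib_left mult.left_commute[of "Y _"])
    then show "(CLINT \<omega>|M. complex_of_real (Y \<omega>) * iexp (\<Sum>j\<in>J. a j * R j \<omega>)) = 0"
      by (intro gaussian_space_integral_mult_iexp_eq_0[OF S Y gaussian_space_sum[OF S J R]])
  qed auto
  then have "complex_of_real (\<integral>\<omega>. Y \<omega> * (\<Prod>j\<in>J. h j (R j \<omega>)) \<partial>M) = 0"
    unfolding integral_complex_of_real[symmetric] of_real_mult .
  then show ?thesis by (simp only: of_real_eq_0_iff)
qed

text \<open>Subtracting from each \<open>X j\<close> its regression on \<open>Y\<close> leaves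
  \<open>R j\<close> uncorrelated with \<open>Y\<close>, and with \<open>R\<close> in place of
  \<open>X\<close> the integral is 0. The regression coefficients are nonpositive, so
  \<open>R j\<close> lies above \<open>X j\<close> where \<open>Y\<close> is nonnegative and below
  it where \<open>Y\<close> is negative. As the \<open>f j\<close> decrease and \<open>g\<close> is
  nonpositive, the replacement raises the integrand in both cases.\<close>

lemma (in prob_space) gaussian_space_integral_mult_prod_nonpos:
  assumes S: "gaussian_space M S" and Y: "Y \<in> S" and L: "L \<in> S" and J: "finite J"
    and X: "\<And>j. j \<in> J \<Longrightarrow> X j \<in> S"
    and YL: "(\<integral>\<omega>. Y \<omega> * L \<omega> \<partial>M) = 0"
    and YX: "\<And>j. j \<in> J \<Longrightarrow> (\<integral>\<omega>. Y \<omega> * X j \<omega> \<partial>M) \<le> 0"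
    and g[measurable]: "g \<in> borel_measurable borel" and g_range: "\<And>x. g x \<le> 0" "\<And>x. - B \<le> g x"
    and f_meas: "\<And>j. j \<in> J \<Longrightarrow> f j \<in> borel_measurable borel"
    and f_range: "\<And>j x. j \<in> J \<Longrightarrow> 0 \<le> f j x" "\<And>j x. j \<in> J \<Longrightarrow> f j x \<le> 1"
    and f_anti: "\<And>j x y. j \<in> J \<Longrightarrow> x \<le> y \<Longrightarrow> f j y \<le> f j x"
  shows "(\<integral>\<omega>. Y \<omega> * (g (L \<omega>) * (\<Prod>j\<in>J. f j (X j \<omega>))) \<partial>M) \<le> 0"
proof -
  have Y_meas[measurable]: "Y \<in> borel_measurable M" and L_meas[measurable]: "L \<in> borel_measurable M"
    and Y_sq: "integrable M (\<lambda>\<omega>. (Y \<omega>)\<^sup>2)"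
    using gaussian_spaceD(1,2)[OF S] Y L by auto
  have iY: "integrable M Y"
    using Y_sq integrable_mult_square_integrable[of Y M "\<lambda>_. 1"] by simp
  define \<sigma>2 where "\<sigma>2 = (\<integral>\<omega>. (Y \<omega>)\<^sup>2 \<partial>M)"
  show ?thesis
  proof (cases "\<sigma>2 = 0")
    \<comment> \<open>Zero variance makes \<open>Y\<close> vanish almost everywhere; the regression
      coefficient below has this variance as its denominator.\<close>
    case True
    then have "AE \<omega> in M. (Y \<omega>)\<^sup>2 = 0"
      using integral_nonneg_eq_0_iff_AE[OF Y_sq] by (simp add: \<sigma>2_def)
    then have "AE \<omega> in M. Y \<omega> * (g (L \<omega>) * (\<Prod>j\<in>J. f j (X j \<omega>))) = 0"
      by eventually_elim simp
    then show ?thesis by (simp add: integral_eq_zero_AE)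
  next
    case False
    then have \<sigma>2: "\<sigma>2 > 0" by (simp add: \<sigma>2_def order_less_le)
    define \<kappa> where "\<kappa> j = (\<integral>\<omega>. Y \<omega> * X j \<omega> \<partial>M) / \<sigma>2" for j
    define R where "R j \<omega> = X j \<omega> - \<kappa> j * Y \<omega>" for j \<omega>
    have \<kappa>: "\<kappa> j \<le> 0" if "j \<in> J" for j
      using YX[OF that] \<sigma>2 by (simp add: \<kappa>_def divide_nonpos_pos)
    have R: "R j \<in> S" if "j \<in> J" for j
    proof -
      have "(\<lambda>\<omega>. 1 * X j \<omega> + (- \<kappa> j) * Y \<omega>) \<in> S"
        by (rule gaussian_spaceD(5)[OF S X[OF that] Y])
      then show ?thesis by (simp add: R_def[abs_def])
    qed
    have X_meas: "X j \<in> borel_measurable M" and R_meas: "R j \<in> borel_measurable M" if "j \<in> J" for j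
      using gaussian_spaceD(1)[OF S] X R that by auto
    have YR: "(\<integral>\<omega>. Y \<omega> * R j \<omega> \<partial>M) = 0" if "j \<in> J" for j
    proof -
      have "integrable M (\<lambda>\<omega>. Y \<omega> * X j \<omega>)"
        using gaussian_spaceD(1,2)[OF S] X[OF that] Y by (intro integrable_mult_square_integrable) auto
      then have "(\<integral>\<omega>. Y \<omega> * X j \<omega> - \<kappa> j * (Y \<omega>)\<^sup>2 \<partial>M) = 0"
        using Y_sq \<sigma>2 by (simp add: \<kappa>_def \<sigma>2_def)
      moreover have "(\<lambda>\<omega>. Y \<omega> * R j \<omega>) = (\<lambda>\<omega>. Y \<omega> * X j \<omega> - \<kappa> j * (Y \<omega>)\<^sup>2)"
        by (simp add: R_def fun_eq_iff power2_eq_square algebra_simps)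
      ultimately show ?thesis by simp
    qed
    have prod01: "0 \<le> (\<Prod>j\<in>J. f j (Z j))" "(\<Prod>j\<in>J. f j (Z j)) \<le> 1" for Z
      using f_range by (auto intro: prod_nonneg prod_le_1)
    have bound: "\<bar>g x * (\<Prod>j\<in>J. f j (Z j))\<bar> \<le> \<bar>B\<bar>" for x Z
    proof -
      have "\<bar>g x\<bar> * \<bar>\<Prod>j\<in>J. f j (Z j)\<bar> \<le> \<bar>B\<bar> * 1"
        using g_range[of x] prod01 by (intro mult_mono) auto
      then show ?thesis by (simp add: abs_mult)
    qed
    have meas: "(\<lambda>\<omega>. g (L \<omega>) * (\<Prod>j\<in>J. f j (Z j \<omega>))) \<in> borel_measurable M"
      if "\<And>j. j \<in> J \<Longrightarrow> Z j \<in> borel_measurable M" for Z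
    proof (intro borel_measurable_times borel_measurable_prod)
      fix j assume j: "j \<in> J"
      show "(\<lambda>\<omega>. f j (Z j \<omega>)) \<in> borel_measurable M"
        by (rule measurable_compose[OF that[OF j] f_meas[OF j]])
    qed measurable
    let ?G = "\<lambda>Z \<omega>. g (L \<omega>) * (\<Prod>j\<in>J. f j (Z j \<omega>))"
    \<comment> \<open>The option type adds one index: \<open>None\<close> carries
      \<open>g (L)\<close>, so that it becomes an ordinary factor of the product. The common bound
      is \<open>max 1 B\<close>, since the \<open>f j\<close> are bounded by 1 and \<open>g\<close>
      by \<open>B\<close>.\<close>
    let ?R' = "\<lambda>j. case j of None \<Rightarrow> L | Some k \<Rightarrow> R k"
    let ?f' = "\<lambda>j. case j of None \<Rightarrow> g | Some k \<Rightarrow> f k"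
    have "(\<integral>\<omega>. Y \<omega> * (\<Prod>j\<in>insert None (Some ` J). ?f' j (?R' j \<omega>)) \<partial>M) = 0"
    proof (rule gaussian_space_integral_mult_prod_eq_0[OF S Y, where R="?R'" and h="?f'" and B="max 1 B"])
      show "\<bar>?f' j x\<bar> \<le> max 1 B" if "j \<in> insert None (Some ` J)" for j x
      proof (cases j)
        case None
        then show ?thesis using g_range[of x] by simp
      next
        case (Some k)
        then have "k \<in> J" using that by auto
        then show ?thesis using Some f_range[of k x] by simp
      qed
    qed (use J L R YL YR f_meas in auto)
    then have 0: "(\<integral>\<omega>. Y \<omega> * ?G R \<omega> \<partial>M) = 0"
      using J by (simp add: prod.reindex)
    have "(\<integral>\<omega>. Y \<omega> * ?G X \<omega> \<partial>M) \<le> (\<integral>\<omega>. Y \<omega> * ?G R \<omega> \<partial>M)"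
    proof (rule integral_mono)
      show "integrable M (\<lambda>\<omega>. Y \<omega> * ?G X \<omega>)" "integrable M (\<lambda>\<omega>. Y \<omega> * ?G R \<omega>)"
        using bound by (auto intro!: integrable_mult_bounded[OF iY, where B="\<bar>B\<bar>"] meas X_meas R_meas)
      fix \<omega>
      show "Y \<omega> * ?G X \<omega> \<le> Y \<omega> * ?G R \<omega>"
      proof (cases "Y \<omega> \<ge> 0")
        case True
        have "R j \<omega> \<ge> X j \<omega>" if "j \<in> J" for j
          using \<kappa>[OF that] True by (simp add: R_def mult_nonpos_nonneg)
        then have "(\<Prod>j\<in>J. f j (R j \<omega>)) \<le> (\<Prod>j\<in>J. f j (X j \<omega>))"
          using f_range f_anti by (intro prod_mono) auto
        then show ?thesis
          using True g_range by (intro mult_left_mono mult_left_mono_neg) auto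
      next
        case False
        have "X j \<omega> \<ge> R j \<omega>" if "j \<in> J" for j
          using \<kappa>[OF that] False by (simp add: R_def mult_nonpos_nonpos)
        then have "(\<Prod>j\<in>J. f j (X j \<omega>)) \<le> (\<Prod>j\<in>J. f j (R j \<omega>))"
          using f_range f_anti by (intro prod_mono) auto
        then show ?thesis
          using False g_range by (intro mult_left_mono_neg) auto
      qed
    qed
    then show ?thesis using 0 by simp
  qed
qed

subsection \<open>Slepian's inequality\<close>

text \<open>The increment of the product along the rotation from \<open>V\<close> to
  \<open>W\<close> is written, for each outcome, as the integral of its derivative \<open>D\<close>.
  Fubini then turns the expected increment into an integral of the expectations of \<open>D\<close>,
  each of which is nonpositive. This order of operations avoids differentiating under the
  expectation.\<close>

lemma (in prob_space) slepian_smooth: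
  fixes V W :: "'t \<Rightarrow> 'a \<Rightarrow> real" and f f' :: "'t \<Rightarrow> real \<Rightarrow> real"
  assumes S: "gaussian_space M S" and F: "finite F"
    and V: "\<And>t. t \<in> F \<Longrightarrow> V t \<in> S" and W: "\<And>t. t \<in> F \<Longrightarrow> W t \<in> S"
    and VW: "\<And>s t. s \<in> F \<Longrightarrow> t \<in> F \<Longrightarrow> (\<integral>\<omega>. V s \<omega> * W t \<omega> \<partial>M) = 0"
    and var: "\<And>t. t \<in> F \<Longrightarrow> (\<integral>\<omega>. V t \<omega> * V t \<omega> \<partial>M) = (\<integral>\<omega>. W t \<omega> * W t \<omega> \<partial>M)"
    and cov: "\<And>s t. s \<in> F \<Longrightarrow> t \<in> F \<Longrightarrow> (\<integral>\<omega>. W s \<omega> * W t \<omega> \<partial>M) \<le> (\<integral>\<omega>. V s \<omega> * V t \<omega> \<partial>M)"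
    and f_range: "\<And>t x. 0 \<le> f t x" "\<And>t x. f t x \<le> 1"
    and f'_range: "\<And>t x. f' t x \<le> 0" "\<And>t x. - B \<le> f' t x"
    and deriv: "\<And>t x. (f t has_real_derivative f' t x) (at x)"
    and f'_cont: "\<And>t x. isCont (f' t) x"
  shows "(\<integral>\<omega>. (\<Prod>t\<in>F. f t (W t \<omega>)) \<partial>M) \<le> (\<integral>\<omega>. (\<Prod>t\<in>F. f t (V t \<omega>)) \<partial>M)"
proof -
  have meas: "L \<in> borel_measurable M" and sq: "integrable M (\<lambda>\<omega>. (L \<omega>)\<^sup>2)" if "L \<in> S" for L
    using gaussian_spaceD(1,2)[OF S] that by auto
  have integrable: "integrable M L" if "L \<in> S" for L
    using integrable_mult_square_integrable[of L M "\<lambda>_. 1"] meas sq that by simp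
  have integrable2: "integrable M (\<lambda>\<omega>. L \<omega> * K \<omega>)" if "L \<in> S" "K \<in> S" for L K
    using meas sq that by (intro integrable_mult_square_integrable) auto
  have f_cont: "isCont (f t) x" for t x
    using deriv DERIV_isCont by blast
  have [measurable]: "f t \<in> borel_measurable borel" "f' t \<in> borel_measurable borel" for t
    using f_cont f'_cont by (auto intro!: borel_measurable_continuous_onI continuous_at_imp_continuous_on)
  have f_anti: "f t y \<le> f t x" if "x \<le> y" for t x y
    using DERIV_nonpos_imp_nonincreasing[OF that] deriv f'_range by blast
  define X where "X i \<theta> \<omega> = cos \<theta> * V i \<omega> + sin \<theta> * W i \<omega>" for i \<theta> \<omega>
  define Y where "Y i \<theta> \<omega> = - sin \<theta> * V i \<omega> + cos \<theta> * W i \<omega>" for i \<theta> \<omega>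
  \<comment> \<open>\<open>G i\<close> is the i-th partial derivative of the product at the point
    \<open>X\<close>, so that \<open>D\<close> is the chain rule applied along the path.\<close>
  define G where "G i \<theta> \<omega> = f' i (X i \<theta> \<omega>) * (\<Prod>k\<in>F-{i}. f k (X k \<theta> \<omega>))" for i \<theta> \<omega>
  define D where "D \<theta> \<omega> = (\<Sum>i\<in>F. Y i \<theta> \<omega> * G i \<theta> \<omega>)" for \<theta> \<omega>
  have X_in: "X i \<theta> \<in> S" and Y_in: "Y i \<theta> \<in> S" if "i \<in> F" for i \<theta>
    using gaussian_spaceD(5)[OF S V[OF that] W[OF that], of "cos \<theta>" "sin \<theta>"]
      gaussian_spaceD(5)[OF S V[OF that] W[OF that], of "- sin \<theta>" "cos \<theta>"]
    unfolding X_def[abs_def] Y_def[abs_def] by simp_all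
  have G_bound: "\<bar>G i \<theta> \<omega>\<bar> \<le> B" for i \<theta> \<omega>
  proof -
    have "\<bar>f' i x\<bar> \<le> B" for x using f'_range[of i x] by simp
    moreover have "\<bar>\<Prod>k\<in>F-{i}. f k (X k \<theta> \<omega>)\<bar> \<le> 1"
      using f_range by (auto simp: abs_prod intro!: prod_le_1)
    ultimately have "\<bar>f' i (X i \<theta> \<omega>)\<bar> * \<bar>\<Prod>k\<in>F-{i}. f k (X k \<theta> \<omega>)\<bar> \<le> B * 1"
      by (intro mult_mono) (auto intro: order_trans[OF abs_ge_zero])
    then show ?thesis by (simp add: G_def abs_mult)
  qed
  \<comment> \<open>The mixed terms vanish by \<open>VW\<close>. The remaining difference of
    covariances is 0 for \<open>i = j\<close> by \<open>var\<close> and nonpositive in general by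
    \<open>cov\<close>, while \<open>sin\<close> and \<open>cos\<close> are nonnegative on the
    quarter circle.\<close>
  have YX: "(\<integral>\<omega>. Y i \<theta> \<omega> * X j \<theta> \<omega> \<partial>M)
      = sin \<theta> * cos \<theta> * ((\<integral>\<omega>. W i \<omega> * W j \<omega> \<partial>M) - (\<integral>\<omega>. V i \<omega> * V j \<omega> \<partial>M))"
    if "i \<in> F" "j \<in> F" for i j \<theta>
  proof -
    have "(\<integral>\<omega>. Y i \<theta> \<omega> * X j \<theta> \<omega> \<partial>M)
        = (\<integral>\<omega>. sin \<theta> * cos \<theta> * (W i \<omega> * W j \<omega>) - sin \<theta> * cos \<theta> * (V i \<omega> * V j \<omega>)
            + cos \<theta> * cos \<theta> * (V j \<omega> * W i \<omega>) - sin \<theta> * sin \<theta> * (V i \<omega> * W j \<omega>) \<partial>M)"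
      by (intro Bochner_Integration.integral_cong refl) (simp add: X_def Y_def algebra_simps)
    also have "\<dots> = sin \<theta> * cos \<theta> * ((\<integral>\<omega>. W i \<omega> * W j \<omega> \<partial>M) - (\<integral>\<omega>. V i \<omega> * V j \<omega> \<partial>M))"
      using integrable2 V W that VW by (simp add: right_diff_distrib)
    finally show ?thesis .
  qed
  have YG: "(\<integral>\<omega>. Y i \<theta> \<omega> * G i \<theta> \<omega> \<partial>M) \<le> 0" if "i \<in> F" "0 \<le> \<theta>" "\<theta> \<le> pi / 2" for i \<theta>
    unfolding G_def
  proof (rule gaussian_space_integral_mult_prod_nonpos[OF S, where Y="Y i \<theta>" and L="X i \<theta>"
        and X="\<lambda>j. X j \<theta>" and g="f' i" and f=f and J="F - {i}" and B=B])
    show "(\<integral>\<omega>. Y i \<theta> \<omega> * X i \<theta> \<omega> \<partial>M) = 0"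
      using that YX var by simp
    show "(\<integral>\<omega>. Y i \<theta> \<omega> * X j \<theta> \<omega> \<partial>M) \<le> 0" if "j \<in> F - {i}" for j
    proof -
      have "sin \<theta> \<ge> 0" "cos \<theta> \<ge> 0"
        using \<open>0 \<le> \<theta>\<close> \<open>\<theta> \<le> pi / 2\<close> by (auto intro!: sin_ge_zero cos_ge_zero)
      then show ?thesis
        using that \<open>i \<in> F\<close> YX cov[of i j] by (simp add: mult_nonneg_nonpos)
    qed
  qed (use that X_in Y_in F f_range f'_range f_anti in auto)
  have YG_int: "integrable M (\<lambda>\<omega>. Y i \<theta> \<omega> * G i \<theta> \<omega>)" if "i \<in> F" for i \<theta>
  proof (rule integrable_mult_bounded)
    show "integrable M (Y i \<theta>)" using Y_in[OF that] integrable by simp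
    show "norm (G i \<theta> \<omega>) \<le> B" for \<omega> using G_bound by simp
    show "G i \<theta> \<in> borel_measurable M"
      unfolding G_def[abs_def] using X_in that
      by (intro borel_measurable_times borel_measurable_prod measurable_compose[OF meas[OF X_in]]) auto
  qed
  have D_int: "integrable M (D \<theta>)" and D_nonpos: "0 \<le> \<theta> \<Longrightarrow> \<theta> \<le> pi / 2 \<Longrightarrow> (\<integral>\<omega>. D \<theta> \<omega> \<partial>M) \<le> 0" for \<theta>
    unfolding D_def[abs_def] using YG_int YG by (auto intro!: sum_nonpos)
  \<comment> \<open>For fixed \<open>\<omega>\<close> the path starts at \<open>V\<close> for angle
    0 and ends at \<open>W\<close> for angle \<open>pi/2\<close>.\<close>
  have FTC: "(\<integral>\<theta>. D \<theta> \<omega> * indicator {0..pi/2} \<theta> \<partial>lborel) = (\<Prod>t\<in>F. f t (W t \<omega>)) - (\<Prod>t\<in>F. f t (V t \<omega>))" for \<omega>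
  proof -
    have "(\<integral>\<theta>. D \<theta> \<omega> * indicator {0..pi/2} \<theta> \<partial>lborel)
        = (\<Prod>t\<in>F. f t (X t (pi/2) \<omega>)) - (\<Prod>t\<in>F. f t (X t 0 \<omega>))"
    proof (rule integral_FTC_Icc_real)
      fix \<theta>
      have X_deriv: "((\<lambda>\<theta>. X t \<theta> \<omega>) has_real_derivative Y t \<theta> \<omega>) (at \<theta>)" for t \<theta>
        unfolding X_def Y_def by (auto intro!: derivative_eq_intros)
      have "((\<lambda>\<theta>. f t (X t \<theta> \<omega>)) has_real_derivative f' t (X t \<theta> \<omega>) * Y t \<theta> \<omega>) (at \<theta>)" for t
        by (rule DERIV_chain2[OF deriv X_deriv])
      from has_field_derivative_prod[OF this]
      show "((\<lambda>\<theta>. \<Prod>t\<in>F. f t (X t \<theta> \<omega>)) has_real_derivative D \<theta> \<omega>) (at \<theta>)"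
        by (simp add: D_def G_def mult_ac)
      have X_cont: "isCont (\<lambda>\<theta>. X t \<theta> \<omega>) \<theta>" and Y_cont: "isCont (\<lambda>\<theta>. Y t \<theta> \<omega>) \<theta>" for t
        unfolding X_def Y_def by (intro continuous_intros)+
      show "isCont (\<lambda>\<theta>. D \<theta> \<omega>) \<theta>"
        unfolding D_def G_def
        by (intro continuous_intros Y_cont isCont_o2[OF X_cont f'_cont] isCont_o2[OF X_cont f_cont])
    qed auto
    then show ?thesis by (simp add: X_def)
  qed
  note integral_meas = borel_measurable_lebesgue_integral
  interpret pair_sigma_finite lborel M ..
  let ?H = "\<lambda>\<theta> \<omega>. D \<theta> \<omega> * indicator {0..pi/2} \<theta>"
  have "integrable (lborel \<Otimes>\<^sub>M M) (case_prod ?H)"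
  proof (rule Fubini_integrable)
    have X_meas: "(\<lambda>x. X i (fst x) (snd x)) \<in> borel_measurable (lborel \<Otimes>\<^sub>M M)"
      and Y_meas: "(\<lambda>x. Y i (fst x) (snd x)) \<in> borel_measurable (lborel \<Otimes>\<^sub>M M)" if "i \<in> F" for i
    proof -
      have [measurable]: "V i \<in> borel_measurable M" "W i \<in> borel_measurable M"
        using that V W meas by auto
      show "(\<lambda>x. X i (fst x) (snd x)) \<in> borel_measurable (lborel \<Otimes>\<^sub>M M)"
        "(\<lambda>x. Y i (fst x) (snd x)) \<in> borel_measurable (lborel \<Otimes>\<^sub>M M)"
        unfolding X_def Y_def by measurable
    qed
    show H_meas: "case_prod ?H \<in> borel_measurable (lborel \<Otimes>\<^sub>M M)"
      unfolding D_def G_def split_beta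
      by (intro borel_measurable_times borel_measurable_sum borel_measurable_prod
          measurable_compose[OF X_meas] Y_meas) auto
    show "AE \<theta> in lborel. integrable M (\<lambda>\<omega>. case_prod ?H (\<theta>, \<omega>))"
      using D_int by simp
    \<comment> \<open>A bound on the expectation of \<open>\<bar>D \<theta>\<bar>\<close> that is
      uniform in the angle: \<open>sin\<close> and \<open>cos\<close> are at most 1 in modulus and
      \<open>G\<close> is at most \<open>B\<close>. Integrability over the bounded range of angles
      follows.\<close>
    define C where "C = (\<Sum>i\<in>F. B * ((\<integral>\<omega>. \<bar>V i \<omega>\<bar> \<partial>M) + (\<integral>\<omega>. \<bar>W i \<omega>\<bar> \<partial>M)))"
    have C: "(\<integral>\<omega>. \<bar>D \<theta> \<omega>\<bar> \<partial>M) \<le> C" for \<theta>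
    proof -
      have "(\<integral>\<omega>. \<bar>D \<theta> \<omega>\<bar> \<partial>M) \<le> (\<integral>\<omega>. (\<Sum>i\<in>F. B * (\<bar>V i \<omega>\<bar> + \<bar>W i \<omega>\<bar>)) \<partial>M)"
      proof (rule integral_mono)
        fix \<omega>
        have "\<bar>D \<theta> \<omega>\<bar> \<le> (\<Sum>i\<in>F. \<bar>Y i \<theta> \<omega> * G i \<theta> \<omega>\<bar>)"
          unfolding D_def by (rule sum_abs)
        also have "\<dots> \<le> (\<Sum>i\<in>F. B * (\<bar>V i \<omega>\<bar> + \<bar>W i \<omega>\<bar>))"
        proof (rule sum_mono)
          fix i
          have "\<bar>Y i \<theta> \<omega>\<bar> \<le> \<bar>sin \<theta>\<bar> * \<bar>V i \<omega>\<bar> + \<bar>cos \<theta>\<bar> * \<bar>W i \<omega>\<bar>"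
            unfolding Y_def by (rule order_trans[OF abs_triangle_ineq]) (simp add: abs_mult)
          also have "\<dots> \<le> 1 * \<bar>V i \<omega>\<bar> + 1 * \<bar>W i \<omega>\<bar>"
            by (intro add_mono mult_right_mono) auto
          finally have "\<bar>Y i \<theta> \<omega>\<bar> \<le> \<bar>V i \<omega>\<bar> + \<bar>W i \<omega>\<bar>" by simp
          then have "\<bar>Y i \<theta> \<omega>\<bar> * \<bar>G i \<theta> \<omega>\<bar> \<le> (\<bar>V i \<omega>\<bar> + \<bar>W i \<omega>\<bar>) * B"
            using G_bound by (intro mult_mono) auto
          then show "\<bar>Y i \<theta> \<omega> * G i \<theta> \<omega>\<bar> \<le> B * (\<bar>V i \<omega>\<bar> + \<bar>W i \<omega>\<bar>)"
            by (simp add: abs_mult mult.commute)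
        qed
        finally show "\<bar>D \<theta> \<omega>\<bar> \<le> (\<Sum>i\<in>F. B * (\<bar>V i \<omega>\<bar> + \<bar>W i \<omega>\<bar>))" .
      qed (use D_int integrable V W in auto)
      also have "\<dots> = C"
        unfolding C_def using integrable V W by (subst Bochner_Integration.integral_sum) auto
      finally show ?thesis .
    qed
    show "integrable lborel (\<lambda>\<theta>. \<integral>\<omega>. norm (case_prod ?H (\<theta>, \<omega>)) \<partial>M)"
    proof (rule Bochner_Integration.integrable_bound)
      show "integrable lborel (\<lambda>\<theta>. C * indicator {0..pi/2} \<theta> :: real)"
        by simp
      have "(\<lambda>x. norm (case_prod ?H x)) \<in> borel_measurable (lborel \<Otimes>\<^sub>M M)"
        by (rule measurable_compose[OF H_meas borel_measurable_norm])
      then show "(\<lambda>\<theta>. \<integral>\<omega>. norm (case_prod ?H (\<theta>, \<omega>)) \<partial>M) \<in> borel_measurable lborel"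
        using integral_meas[of "\<lambda>\<theta> \<omega>. norm (?H \<theta> \<omega>)" lborel]
        by (simp add: split_beta')
      show "AE \<theta> in lborel. norm (\<integral>\<omega>. norm (case_prod ?H (\<theta>, \<omega>)) \<partial>M) \<le> norm (C * indicator {0..pi/2} \<theta>)"
        using C by (intro AE_I2) (auto simp: indicator_def intro!: order_trans[OF _ abs_ge_self])
    qed
  qed
  from Fubini_integral[OF this]
  have "(\<integral>\<omega>. (\<Prod>t\<in>F. f t (W t \<omega>)) - (\<Prod>t\<in>F. f t (V t \<omega>)) \<partial>M) = (\<integral>\<theta>. (\<integral>\<omega>. ?H \<theta> \<omega> \<partial>M) \<partial>lborel)"
    by (simp add: FTC)
  also have "\<dots> = - (\<integral>\<theta>. - (\<integral>\<omega>. D \<theta> \<omega> \<partial>M) * indicator {0..pi/2} \<theta> \<partial>lborel)"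
    by simp
  also have "\<dots> \<le> 0"
  proof -
    have "0 \<le> (\<integral>\<theta>. - (\<integral>\<omega>. D \<theta> \<omega> \<partial>M) * indicator {0..pi/2} \<theta> \<partial>lborel)"
      using D_nonpos by (intro Bochner_Integration.integral_nonneg) (auto simp: indicator_def)
    then show ?thesis by (simp only: neg_le_0_iff_le)
  qed
  finally have "(\<integral>\<omega>. (\<Prod>t\<in>F. f t (W t \<omega>)) - (\<Prod>t\<in>F. f t (V t \<omega>)) \<partial>M) \<le> 0" .
  moreover have "integrable M (\<lambda>\<omega>. \<Prod>t\<in>F. f t (Z t \<omega>))" if Z: "\<And>t. t \<in> F \<Longrightarrow> Z t \<in> S" for Z
  proof (rule integrable_const_bound[where B=1])
    show "AE \<omega> in M. norm (\<Prod>t\<in>F. f t (Z t \<omega>)) \<le> 1"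
      using f_range by (auto simp: abs_prod intro!: prod_le_1)
    show "(\<lambda>\<omega>. \<Prod>t\<in>F. f t (Z t \<omega>)) \<in> borel_measurable M"
      by (intro borel_measurable_prod measurable_compose[OF meas[OF Z]]) auto
  qed
  ultimately show ?thesis using V W by simp
qed

text \<open>The indicators of the half-lines \<open>{..b t}\<close> are limits of smooth decreasing
  functions with values in [0, 1], and the product of the indicators is the event that no barrier is
  crossed. The smooth inequality passes to the limit, and taking complements reverses its
  direction.\<close>

lemma (in prob_space) slepian:
  fixes V W :: "'t \<Rightarrow> 'a \<Rightarrow> real" and b :: "'t \<Rightarrow> real"
  assumes S: "gaussian_space M S" and F: "finite F"
    and V: "\<And>t. t \<in> F \<Longrightarrow> V t \<in> S" and W: "\<And>t. t \<in> F \<Longrightarrow> W t \<in> S"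
    and VW: "\<And>s t. s \<in> F \<Longrightarrow> t \<in> F \<Longrightarrow> (\<integral>\<omega>. V s \<omega> * W t \<omega> \<partial>M) = 0"
    and var: "\<And>t. t \<in> F \<Longrightarrow> (\<integral>\<omega>. V t \<omega> * V t \<omega> \<partial>M) = (\<integral>\<omega>. W t \<omega> * W t \<omega> \<partial>M)"
    and cov: "\<And>s t. s \<in> F \<Longrightarrow> t \<in> F \<Longrightarrow> (\<integral>\<omega>. W s \<omega> * W t \<omega> \<partial>M) \<le> (\<integral>\<omega>. V s \<omega> * V t \<omega> \<partial>M)"
  shows "\<P>(\<omega> in M. \<exists>t\<in>F. V t \<omega> > b t) \<le> \<P>(\<omega> in M. \<exists>t\<in>F. W t \<omega> > b t)"
proof -
  \<comment> \<open>The factor \<open>n^2\<close> dominates away from the barrier. The shift by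
    \<open>- n\<close> decides the case \<open>x = b t\<close>: there \<open>z\<close> tends to
    minus infinity, so \<open>f n t x\<close> tends to 1, as required by the closed half-line and
    the strict inequality in the event.\<close>
  define z where "z n t x = (real n)\<^sup>2 * (x - b t) - real n" for n t x
  define f where "f n t x = exp (- exp (z n t x))" for n t x
  have lim: "(\<lambda>n. f n t x) \<longlonglongrightarrow> indicator {..b t} x" for t x
  proof -
    have *: "(\<lambda>n. exp (- exp ((real n)\<^sup>2 * y - real n))) \<longlonglongrightarrow> indicator {..0} y" for y :: real
    proof -
      consider "y < 0" | "y = 0" | "y > 0" by linarith
      then show ?thesis
        by cases (simp_all, real_asymp+)
    qed
    show ?thesis
      using *[of "x - b t"] by (simp add: f_def z_def indicator_def)
  qed
  have limF: "(\<lambda>n. \<integral>\<omega>. (\<Prod>t\<in>F. f n t (Z t \<omega>)) \<partial>M) \<longlonglongrightarrow> 1 - \<P>(\<omega> in M. \<exists>t\<in>F. Z t \<omega> > b t)"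
    if Z: "\<And>t. t \<in> F \<Longrightarrow> Z t \<in> borel_measurable M" for Z
  proof -
    have "(\<lambda>n. \<integral>\<omega>. (\<Prod>t\<in>F. f n t (Z t \<omega>)) \<partial>M) \<longlonglongrightarrow> (\<integral>\<omega>. (\<Prod>t\<in>F. indicator {..b t} (Z t \<omega>)) \<partial>M)"
    proof (rule integral_dominated_convergence)
      show "integrable M (\<lambda>_. 1 :: real)" by simp
      show "AE \<omega> in M. (\<lambda>n. \<Prod>t\<in>F. f n t (Z t \<omega>)) \<longlonglongrightarrow> (\<Prod>t\<in>F. indicator {..b t} (Z t \<omega>))"
        by (intro AE_I2 tendsto_prod lim)
      show "AE \<omega> in M. norm (\<Prod>t\<in>F. f n t (Z t \<omega>)) \<le> 1" for n
        by (auto simp: f_def abs_prod intro!: prod_le_1)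
      show "(\<lambda>\<omega>. \<Prod>t\<in>F. indicator {..b t} (Z t \<omega>) :: real) \<in> borel_measurable M"
      proof (rule borel_measurable_prod)
        fix t assume "t \<in> F"
        note [measurable] = Z[OF this]
        show "(\<lambda>\<omega>. indicator {..b t} (Z t \<omega>) :: real) \<in> borel_measurable M"
          by measurable
      qed
      show "(\<lambda>\<omega>. \<Prod>t\<in>F. f n t (Z t \<omega>)) \<in> borel_measurable M" for n
        unfolding f_def z_def by (intro borel_measurable_prod measurable_compose[OF Z]) auto
    qed
    also have "(\<integral>\<omega>. (\<Prod>t\<in>F. indicator {..b t} (Z t \<omega>) :: real) \<partial>M)
        = (\<integral>\<omega>. indicator (space M - {\<omega>\<in>space M. \<exists>t\<in>F. Z t \<omega> > b t}) \<omega> \<partial>M)"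
    proof (rule Bochner_Integration.integral_cong[OF refl])
      fix \<omega> assume "\<omega> \<in> space M"
      then show "(\<Prod>t\<in>F. indicator {..b t} (Z t \<omega>) :: real) = (indicator (space M - {\<omega>\<in>space M. \<exists>t\<in>F. Z t \<omega> > b t}) \<omega> :: real)"
        using F by (auto simp: indicator_def not_less intro!: prod.neutral)
    qed
    also have "{\<omega>\<in>space M. \<exists>t\<in>F. Z t \<omega> > b t} \<in> events"
    proof -
      have "{\<omega>\<in>space M. \<exists>t\<in>F. Z t \<omega> > b t} = (\<Union>t\<in>F. {\<omega>\<in>space M. Z t \<omega> > b t})" by auto
      then show ?thesis
        using F Z by (auto intro!: sets.finite_UN borel_measurable_less)
    qed
    then have "(\<integral>\<omega>. indicator (space M - {\<omega>\<in>space M. \<exists>t\<in>F. Z t \<omega> > b t}) \<omega> \<partial>M) = 1 - \<P>(\<omega> in M. \<exists>t\<in>F. Z t \<omega> > b t)"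
      by (simp add: prob_compl)
    finally show ?thesis .
  qed
  have "(\<integral>\<omega>. (\<Prod>t\<in>F. f n t (W t \<omega>)) \<partial>M) \<le> (\<integral>\<omega>. (\<Prod>t\<in>F. f n t (V t \<omega>)) \<partial>M)" for n
  proof -
    let ?f' = "\<lambda>t x. - (real n)\<^sup>2 * (exp (z n t x) * exp (- exp (z n t x)))"
    show ?thesis
    proof (rule slepian_smooth[OF S F V W VW var cov, where f="f n" and f'="?f'" and B="(real n)\<^sup>2"])
      fix t x
      show "(f n t has_real_derivative ?f' t x) (at x)"
        unfolding f_def z_def by (auto intro!: derivative_eq_intros)
      show "isCont (?f' t) x"
        unfolding z_def by (intro continuous_intros)
      \<comment> \<open>With y = \<open>exp (z n t x)\<close>, the bound y exp (-y) \<le> 1 gives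
        the lower bound \<open>- n^2\<close> on the derivative.\<close>
      have "exp (z n t x) \<le> exp (exp (z n t x))"
        using exp_ge_add_one_self[of "exp (z n t x)"] by linarith
      then have "exp (z n t x) * exp (- exp (z n t x)) \<le> 1"
        by (simp add: exp_minus field_simps)
      then have "(real n)\<^sup>2 * (exp (z n t x) * exp (- exp (z n t x))) \<le> (real n)\<^sup>2 * 1"
        by (intro mult_left_mono) auto
      then show "- ((real n)\<^sup>2) \<le> ?f' t x" by simp
    qed (auto simp: f_def)
  qed
  then have "1 - \<P>(\<omega> in M. \<exists>t\<in>F. W t \<omega> > b t) \<le> 1 - \<P>(\<omega> in M. \<exists>t\<in>F. V t \<omega> > b t)"
    using V W gaussian_spaceD(1)[OF S] by (intro LIMSEQ_le[OF limF limF]) auto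
  then show ?thesis by simp
qed

subsection \<open>Sums of squares\<close>

lemma centered_gaussian_processD:
  assumes "centered_gaussian_process M T X" and "F \<subseteq> T" and "finite F"
  shows "gaussian_rv M (\<lambda>\<omega>. \<Sum>t\<in>F. a t * X t \<omega>)"
    and "t \<in> T \<Longrightarrow> gaussian_rv M (X t)" and "t \<in> T \<Longrightarrow> (\<integral>\<omega>. X t \<omega> \<partial>M) = 0"
    and "t \<in> T \<Longrightarrow> X t \<in> borel_measurable M"
proof -
  have *: "gaussian_rv M (\<lambda>\<omega>. \<Sum>t\<in>F. a t * X t \<omega>)" if "finite F" "F \<subseteq> T" for F a
    using assms(1) that by (simp add: centered_gaussian_process_def gaussian_process_def)
  show "gaussian_rv M (\<lambda>\<omega>. \<Sum>t\<in>F. a t * X t \<omega>)"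
    using * assms(2,3) by blast
  show X: "gaussian_rv M (X t)" if "t \<in> T"
    using *[of "{t}" "\<lambda>_. 1"] that by simp
  then show "t \<in> T \<Longrightarrow> X t \<in> borel_measurable M"
    by (simp add: gaussian_rv_def)
  show "t \<in> T \<Longrightarrow> (\<integral>\<omega>. X t \<omega> \<partial>M) = 0"
    using assms(1) by (simp add: centered_gaussian_process_def)
qed

text \<open>Each member of the span splits into a \<open>V\<close> part and a \<open>W\<close> part,
  which are independent, centered and Gaussian. Characteristic functions therefore multiply while
  second moments add, and this preserves the Gaussian formula.\<close>

lemma (in prob_space) gaussian_space_indep_processes:
  fixes V W :: "'t \<Rightarrow> 'a \<Rightarrow> real"
  assumes V: "centered_gaussian_process M T V" and W: "centered_gaussian_process M T W"
    and F: "finite F" "F \<subseteq> T"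
    and indep: "indep_var (PiM F (\<lambda>_. borel)) (\<lambda>\<omega>. \<lambda>t\<in>F. V t \<omega>) (PiM F (\<lambda>_. borel)) (\<lambda>\<omega>. \<lambda>t\<in>F. W t \<omega>)"
  shows "gaussian_space M {L. \<exists>a b. L = (\<lambda>\<omega>. (\<Sum>t\<in>F. a t * V t \<omega>) + (\<Sum>t\<in>F. b t * W t \<omega>))}" (is "gaussian_space M ?S")
    and "s \<in> F \<Longrightarrow> t \<in> F \<Longrightarrow> (\<integral>\<omega>. V s \<omega> * W t \<omega> \<partial>M) = 0"
proof -
  note VD = centered_gaussian_processD[OF V F(2,1)] and WD = centered_gaussian_processD[OF W F(2,1)]
  have rv: "gaussian_rv M (\<lambda>\<omega>. \<Sum>t\<in>F. a t * X t \<omega>)" "expectation (\<lambda>\<omega>. \<Sum>t\<in>F. a t * X t \<omega>) = 0"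
    if X: "centered_gaussian_process M T X" for X a
  proof -
    note D = centered_gaussian_processD[OF X F(2,1)]
    show "gaussian_rv M (\<lambda>\<omega>. \<Sum>t\<in>F. a t * X t \<omega>)" by (rule D(1))
    have "integrable M (X t)" if "t \<in> F" for t
      using D(2) gaussian_rv_integrable(1) that F by blast
    then have "expectation (\<lambda>\<omega>. \<Sum>t\<in>F. a t * X t \<omega>) = (\<Sum>t\<in>F. a t * expectation (X t))"
      by (subst Bochner_Integration.integral_sum) auto
    also have "\<dots> = 0"
      using D(3) F by (intro sum.neutral) auto
    finally show "expectation (\<lambda>\<omega>. \<Sum>t\<in>F. a t * X t \<omega>) = 0" .
  qed
  have meas_sum: "(\<lambda>p. \<Sum>t\<in>F. a t * p t) \<in> borel_measurable (PiM F (\<lambda>_. borel))" for a :: "'t \<Rightarrow> real"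
    by (intro borel_measurable_sum borel_measurable_times measurable_component_singleton) auto
  have indep': "indep_var borel (\<lambda>\<omega>. \<Sum>t\<in>F. a t * V t \<omega>) borel (\<lambda>\<omega>. \<Sum>t\<in>F. b t * W t \<omega>)" for a b
    using indep_var_compose[OF indep meas_sum[of a] meas_sum[of b]]
    by (simp add: comp_def)
  show "(\<integral>\<omega>. V s \<omega> * W t \<omega> \<partial>M) = 0" if st: "s \<in> F" "t \<in> F"
  proof -
    have "indep_var borel (V s) borel (W t)"
      using indep_var_compose[OF indep measurable_component_singleton[OF st(1)] measurable_component_singleton[OF st(2)]] st
      by (simp add: comp_def)
    moreover have "integrable M (V s)" "integrable M (W t)"
      using st F by (auto intro!: gaussian_rv_integrable(1) VD(2) WD(2))
    ultimately show ?thesis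
      using VD(3)[of s] st F by (subst indep_var_lebesgue_integral) auto
  qed
  show "gaussian_space M ?S"
    unfolding gaussian_space_def
  proof (intro conjI ballI allI)
    fix L assume "L \<in> ?S"
    then obtain a b where L: "L = (\<lambda>\<omega>. (\<Sum>t\<in>F. a t * V t \<omega>) + (\<Sum>t\<in>F. b t * W t \<omega>))" by blast
    define A where "A \<omega> = (\<Sum>t\<in>F. a t * V t \<omega>)" for \<omega>
    define B where "B \<omega> = (\<Sum>t\<in>F. b t * W t \<omega>)" for \<omega>
    have LAB: "L = (\<lambda>\<omega>. A \<omega> + B \<omega>)" by (simp add: L A_def B_def)
    have A: "gaussian_rv M A" "expectation A = 0" and B: "gaussian_rv M B" "expectation B = 0"
      using rv[OF V] rv[OF W] by (simp_all add: A_def[abs_def] B_def[abs_def])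
    have AB: "indep_var borel A borel B"
      using indep' by (simp add: A_def[abs_def] B_def[abs_def])
    have [measurable]: "A \<in> borel_measurable M" "B \<in> borel_measurable M"
      using A B by (simp_all add: gaussian_rv_def)
    note intA = gaussian_rv_integrable[OF A(1)] and intB = gaussian_rv_integrable[OF B(1)]
    have intAB: "integrable M (\<lambda>\<omega>. A \<omega> * B \<omega>)"
      using intA intB by (intro integrable_mult_square_integrable) auto
    show "L \<in> borel_measurable M" unfolding LAB by measurable
    have sq: "(L \<omega>)\<^sup>2 = (A \<omega>)\<^sup>2 + 2 * (A \<omega> * B \<omega>) + (B \<omega>)\<^sup>2" for \<omega>
      by (simp add: LAB power2_eq_square algebra_simps)
    show "integrable M (\<lambda>\<omega>. (L \<omega>)\<^sup>2)"
      unfolding sq using intA intB intAB by simp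
    have var: "(\<integral>\<omega>. (L \<omega>)\<^sup>2 \<partial>M) = (\<integral>\<omega>. (A \<omega>)\<^sup>2 \<partial>M) + (\<integral>\<omega>. (B \<omega>)\<^sup>2 \<partial>M)"
      unfolding sq using intA intB intAB indep_var_lebesgue_integral[OF AB] A B by simp
    have char: "char (distr M borel X) 1 = (CLINT \<omega>|M. iexp (X \<omega>))"
      if [measurable]: "X \<in> borel_measurable M" for X
      unfolding char_def by (subst integral_distr) auto
    have "(CLINT \<omega>|M. iexp (L \<omega>)) = (CLINT \<omega>|M. iexp (A \<omega>)) * (CLINT \<omega>|M. iexp (B \<omega>))"
      using char_distr_add[OF AB, of 1] unfolding LAB by (subst (asm) (1 2 3) char) auto
    then show "(CLINT \<omega>|M. iexp (L \<omega>)) = exp (- complex_of_real (\<integral>\<omega>. (L \<omega>)\<^sup>2 \<partial>M) / 2)"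
      unfolding var gaussian_rv_iexp[OF A] gaussian_rv_iexp[OF B]
      by (simp add: exp_add[symmetric] field_simps)
  next
    show "(\<lambda>_. 0) \<in> ?S"
      by (intro CollectI exI[of _ "\<lambda>_. 0"]) simp
  next
    fix L K p q assume "L \<in> ?S" "K \<in> ?S"
    then obtain a b a' b' where L: "L = (\<lambda>\<omega>. (\<Sum>t\<in>F. a t * V t \<omega>) + (\<Sum>t\<in>F. b t * W t \<omega>))"
      and K: "K = (\<lambda>\<omega>. (\<Sum>t\<in>F. a' t * V t \<omega>) + (\<Sum>t\<in>F. b' t * W t \<omega>))" by blast
    show "(\<lambda>\<omega>. p * L \<omega> + q * K \<omega>) \<in> ?S"
      by (intro CollectI exI[of _ "\<lambda>t. p * a t + q * a' t"] exI[of _ "\<lambda>t. p * b t + q * b' t"])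
         (simp add: L K fun_eq_iff algebra_simps sum.distrib sum_distrib_left)
  qed
qed

text \<open>Here the other summands are frozen to a deterministic \<open>r\<close>. The event for
  \<open>V\<close> is the union of the barrier crossings of \<open>V\<close> and of
  \<open>- V\<close>, and each of these is at most as likely as a crossing by \<open>W\<close>. The
  union bound yields the factor 2.\<close>

lemma (in prob_space) slepian_square:
  fixes V W :: "'t \<Rightarrow> 'a \<Rightarrow> real" and r :: "'t \<Rightarrow> real"
  assumes V: "centered_gaussian_process M T V" and W: "centered_gaussian_process M T W"
    and F: "finite F" "F \<subseteq> T"
    and indep: "indep_var (PiM F (\<lambda>_. borel)) (\<lambda>\<omega>. \<lambda>t\<in>F. V t \<omega>) (PiM F (\<lambda>_. borel)) (\<lambda>\<omega>. \<lambda>t\<in>F. W t \<omega>)"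
    and var: "\<And>t. t \<in> F \<Longrightarrow> (\<integral>\<omega>. (V t \<omega>)\<^sup>2 \<partial>M) = (\<integral>\<omega>. (W t \<omega>)\<^sup>2 \<partial>M)"
    and cov: "\<And>s t. s \<in> F \<Longrightarrow> t \<in> F \<Longrightarrow> (\<integral>\<omega>. W s \<omega> * W t \<omega> \<partial>M) \<le> (\<integral>\<omega>. V s \<omega> * V t \<omega> \<partial>M)"
  shows "\<P>(\<omega> in M. \<exists>t\<in>F. (V t \<omega>)\<^sup>2 + r t > u) \<le> 2 * \<P>(\<omega> in M. \<exists>t\<in>F. (W t \<omega>)\<^sup>2 + r t > u)"
proof (cases "\<exists>t\<in>F. r t > u")
  case True
  then obtain t where "t \<in> F" "r t > u" by blast
  \<comment> \<open>If \<open>r\<close> alone exceeds \<open>u\<close> somewhere, the event for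
    \<open>W\<close> is certain and the right-hand side equals 2.\<close>
  then have "{\<omega>\<in>space M. \<exists>t\<in>F. (W t \<omega>)\<^sup>2 + r t > u} = space M"
    by (auto intro!: bexI[of _ t] add_nonneg_pos simp: add_strict_increasing2)
  then have "2 * \<P>(\<omega> in M. \<exists>t\<in>F. (W t \<omega>)\<^sup>2 + r t > u) = 2"
    by (simp add: prob_space)
  then show ?thesis
    using prob_le_1[of "{\<omega>\<in>space M. \<exists>t\<in>F. (V t \<omega>)\<^sup>2 + r t > u}"] by linarith
next
  case False
  define b where "b t = sqrt (u - r t)" for t
  \<comment> \<open>\<open>sqrt\<close> is strictly increasing on the whole real line and maps the
    square of \<bar>x\<bar> back to \<bar>x\<bar>.\<close>
  have iff: "x\<^sup>2 + r t > u \<longleftrightarrow> \<bar>x\<bar> > b t" if "t \<in> F" for x t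
  proof -
    have "x\<^sup>2 + r t > u \<longleftrightarrow> u - r t < \<bar>x\<bar>\<^sup>2" by auto
    also have "\<dots> \<longleftrightarrow> b t < \<bar>x\<bar>"
      unfolding b_def using real_less_rsqrt[of "\<bar>x\<bar>"] real_sqrt_less_iff[of "u - r t" "\<bar>x\<bar>\<^sup>2"] by simp
    finally show ?thesis .
  qed
  have meas: "V t \<in> borel_measurable M" "W t \<in> borel_measurable M" if "t \<in> F" for t
    using centered_gaussian_processD(4)[OF V F(2,1)] centered_gaussian_processD(4)[OF W F(2,1)] that F by auto
  have events: "{\<omega>\<in>space M. \<exists>t\<in>F. Z t \<omega> > b t} \<in> events"
    if "\<And>t. t \<in> F \<Longrightarrow> Z t \<in> borel_measurable M" for Z
  proof -
    have "{\<omega>\<in>space M. \<exists>t\<in>F. Z t \<omega> > b t} = (\<Union>t\<in>F. {\<omega>\<in>space M. Z t \<omega> > b t})" by auto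
    then show ?thesis
      using F that by (auto intro!: sets.finite_UN borel_measurable_less)
  qed
  note S = gaussian_space_indep_processes[OF V W F indep]
  let ?S = "{L. \<exists>a b. L = (\<lambda>\<omega>. (\<Sum>t\<in>F. a t * V t \<omega>) + (\<Sum>t\<in>F. b t * W t \<omega>))}"
  have mem: "(\<lambda>\<omega>. c * V t \<omega>) \<in> ?S" "W t \<in> ?S" if "t \<in> F" for t c
  proof -
    have "(\<Sum>s\<in>F. (if s = t then c else 0) * Z s \<omega>) = c * Z t \<omega>" for c and Z :: "'t \<Rightarrow> 'a \<Rightarrow> real" and \<omega>
      using F that by (simp add: if_distrib[of "\<lambda>x. x * _"] cong: if_cong)
    note sum = this
    show "(\<lambda>\<omega>. c * V t \<omega>) \<in> ?S"
      by (intro CollectI exI[of _ "\<lambda>s. if s = t then c else 0"] exI[of _ "\<lambda>_. 0"]) (simp add: sum)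
    show "W t \<in> ?S"
      by (intro CollectI exI[of _ "\<lambda>s. if s = t then 1 else 0"] exI[of _ "\<lambda>_. 0"]) (simp add: sum)
  qed
  \<comment> \<open>The constant \<open>c\<close> is a sign, 1 or -1: multiplying by it preserves
    the covariances of \<open>V\<close> and the orthogonality to \<open>W\<close>.\<close>
  have *: "\<P>(\<omega> in M. \<exists>t\<in>F. c * V t \<omega> > b t) \<le> \<P>(\<omega> in M. \<exists>t\<in>F. W t \<omega> > b t)" if c: "c * c = 1" for c
  proof (rule slepian[OF S(1) F(1)])
    fix s t assume st: "s \<in> F" "t \<in> F"
    show "(\<lambda>\<omega>. c * V t \<omega>) \<in> ?S" "W t \<in> ?S" using mem st by auto
    show "(\<integral>\<omega>. c * V s \<omega> * W t \<omega> \<partial>M) = 0"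
      using S(2)[OF st] by (simp add: mult.assoc)
    have cc: "(\<integral>\<omega>. c * V s \<omega> * (c * V t \<omega>) \<partial>M) = (\<integral>\<omega>. V s \<omega> * V t \<omega> \<partial>M)" for s t
    proof -
      have "c * x * (c * y) = x * y" for x y
      proof -
        have "c * x * (c * y) = c * c * (x * y)" by (simp add: mult_ac)
        then show ?thesis using c by simp
      qed
      then show ?thesis by (simp only:)
    qed
    show "(\<integral>\<omega>. c * V t \<omega> * (c * V t \<omega>) \<partial>M) = (\<integral>\<omega>. W t \<omega> * W t \<omega> \<partial>M)"
      unfolding cc using var[OF st(2)] by (simp add: power2_eq_square)
    show "(\<integral>\<omega>. W s \<omega> * W t \<omega> \<partial>M) \<le> (\<integral>\<omega>. c * V s \<omega> * (c * V t \<omega>) \<partial>M)"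
      unfolding cc using cov[OF st] .
  qed
  have abs_iff: "\<bar>x\<bar> > y \<longleftrightarrow> 1 * x > y \<or> (-1) * x > y" for x y :: real
    by auto
  have "(\<exists>t\<in>F. (V t \<omega>)\<^sup>2 + r t > u) \<longleftrightarrow> (\<exists>t\<in>F. 1 * V t \<omega> > b t) \<or> (\<exists>t\<in>F. (-1) * V t \<omega> > b t)" for \<omega>
    unfolding bex_disj_distrib[symmetric] by (intro bex_cong refl) (simp only: iff abs_iff)
  then have "{\<omega>\<in>space M. \<exists>t\<in>F. (V t \<omega>)\<^sup>2 + r t > u}
      = {\<omega>\<in>space M. \<exists>t\<in>F. 1 * V t \<omega> > b t} \<union> {\<omega>\<in>space M. \<exists>t\<in>F. (-1) * V t \<omega> > b t}"
    by blast
  then have "\<P>(\<omega> in M. \<exists>t\<in>F. (V t \<omega>)\<^sup>2 + r t > u)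
      \<le> \<P>(\<omega> in M. \<exists>t\<in>F. 1 * V t \<omega> > b t) + \<P>(\<omega> in M. \<exists>t\<in>F. (-1) * V t \<omega> > b t)"
    using meas by (auto intro!: measure_Un_le events)
  also have "\<dots> \<le> 2 * \<P>(\<omega> in M. \<exists>t\<in>F. W t \<omega> > b t)"
    using *[of 1] *[of "-1"] by simp
  also have "\<P>(\<omega> in M. \<exists>t\<in>F. W t \<omega> > b t) \<le> \<P>(\<omega> in M. \<exists>t\<in>F. \<bar>W t \<omega>\<bar> > b t)"
    using meas by (intro finite_measure_mono events) (force intro: less_le_trans[OF _ abs_ge_self])+
  also have "{\<omega>\<in>space M. \<exists>t\<in>F. \<bar>W t \<omega>\<bar> > b t} = {\<omega>\<in>space M. \<exists>t\<in>F. (W t \<omega>)\<^sup>2 + r t > u}"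
    using iff by auto
  finally show ?thesis by simp
qed

text \<open>Independence makes the joint law of \<open>V\<close> and \<open>R\<close> at the times
  in \<open>F\<close> a product, and likewise for \<open>W\<close> and \<open>R\<close>. By Fubini
  both probabilities are integrals over the same law of \<open>R\<close> of probabilities with
  \<open>R\<close> frozen at \<open>r\<close>, to which the deterministic case applies
  pointwise.\<close>

lemma (in prob_space) slepian_square_plus_indep:
  fixes V W R :: "'t \<Rightarrow> 'a \<Rightarrow> real"
  assumes V: "centered_gaussian_process M T V" and W: "centered_gaussian_process M T W"
    and F: "finite F" "F \<subseteq> T"
    and VW: "indep_var (PiM F (\<lambda>_. borel)) (\<lambda>\<omega>. \<lambda>t\<in>F. V t \<omega>) (PiM F (\<lambda>_. borel)) (\<lambda>\<omega>. \<lambda>t\<in>F. W t \<omega>)"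
    and VR: "indep_var (PiM F (\<lambda>_. borel)) (\<lambda>\<omega>. \<lambda>t\<in>F. V t \<omega>) (PiM F (\<lambda>_. borel)) (\<lambda>\<omega>. \<lambda>t\<in>F. R t \<omega>)"
    and WR: "indep_var (PiM F (\<lambda>_. borel)) (\<lambda>\<omega>. \<lambda>t\<in>F. W t \<omega>) (PiM F (\<lambda>_. borel)) (\<lambda>\<omega>. \<lambda>t\<in>F. R t \<omega>)"
    and var: "\<And>t. t \<in> F \<Longrightarrow> (\<integral>\<omega>. (V t \<omega>)\<^sup>2 \<partial>M) = (\<integral>\<omega>. (W t \<omega>)\<^sup>2 \<partial>M)"
    and cov: "\<And>s t. s \<in> F \<Longrightarrow> t \<in> F \<Longrightarrow> (\<integral>\<omega>. W s \<omega> * W t \<omega> \<partial>M) \<le> (\<integral>\<omega>. V s \<omega> * V t \<omega> \<partial>M)"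
  shows "\<P>(\<omega> in M. \<exists>t\<in>F. (V t \<omega>)\<^sup>2 + R t \<omega> > u) \<le> 2 * \<P>(\<omega> in M. \<exists>t\<in>F. (W t \<omega>)\<^sup>2 + R t \<omega> > u)"
proof -
  let ?P = "PiM F (\<lambda>_. borel :: real measure)"
  let ?r = "\<lambda>X \<omega>. \<lambda>t\<in>F. X t \<omega>"
  let ?D = "\<lambda>X. distr M ?P (?r X)"
  define B where "B = {x \<in> space (?P \<Otimes>\<^sub>M ?P). \<exists>t\<in>F. (fst x t)\<^sup>2 + snd x t > u}"
  have B: "B \<in> sets (?P \<Otimes>\<^sub>M ?P)"
  proof -
    have "B = (\<Union>t\<in>F. {x \<in> space (?P \<Otimes>\<^sub>M ?P). (fst x t)\<^sup>2 + snd x t > u})"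
      by (auto simp: B_def)
    also have "\<dots> \<in> sets (?P \<Otimes>\<^sub>M ?P)"
    proof (intro sets.finite_UN F)
      fix t assume t: "t \<in> F"
      have [measurable]: "(\<lambda>x. fst x t) \<in> borel_measurable (?P \<Otimes>\<^sub>M ?P)" "(\<lambda>x. snd x t) \<in> borel_measurable (?P \<Otimes>\<^sub>M ?P)"
        by (rule measurable_compose[OF measurable_fst measurable_component_singleton[OF t]],
            rule measurable_compose[OF measurable_snd measurable_component_singleton[OF t]])
      show "{x \<in> space (?P \<Otimes>\<^sub>M ?P). (fst x t)\<^sup>2 + snd x t > u} \<in> sets (?P \<Otimes>\<^sub>M ?P)"
        by measurable
    qed
    finally show ?thesis .
  qed
  have slice: "emeasure (?D X) ((\<lambda>x. (x, r)) -` B) = ennreal (\<P>(\<omega> in M. \<exists>t\<in>F. (X t \<omega>)\<^sup>2 + r t > u))"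
    if [measurable]: "?r X \<in> measurable M ?P" and r: "r \<in> space ?P" for X r
  proof -
    have "(\<lambda>x. (x, r)) -` B \<in> sets ?P"
      using B by (rule sets_Pair2)
    then have "emeasure (?D X) ((\<lambda>x. (x, r)) -` B) = emeasure M (?r X -` ((\<lambda>x. (x, r)) -` B) \<inter> space M)"
      by (intro emeasure_distr) measurable
    also have "?r X -` ((\<lambda>x. (x, r)) -` B) \<inter> space M = {\<omega>\<in>space M. \<exists>t\<in>F. (X t \<omega>)\<^sup>2 + r t > u}"
      using r by (auto simp: B_def space_pair_measure space_PiM)
    finally show ?thesis
      by (simp only: emeasure_eq_measure)
  qed
  \<comment> \<open>Stated for a generic \<open>X\<close>, to be used once with \<open>V\<close> and
    once with \<open>W\<close>; the set \<open>B\<close> and the law of \<open>R\<close> are the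
    same in both uses.\<close>
  have fubini: "?r X \<in> measurable M ?P"
    "(\<lambda>r. emeasure (?D X) ((\<lambda>x. (x, r)) -` B)) \<in> borel_measurable (?D R)"
    "emeasure M {\<omega>\<in>space M. \<exists>t\<in>F. (X t \<omega>)\<^sup>2 + R t \<omega> > u}
      = (\<integral>\<^sup>+r. emeasure (?D X) ((\<lambda>x. (x, r)) -` B) \<partial>?D R)"
    if XR: "indep_var ?P (?r X) ?P (?r R)" for X
  proof -
    have XR': "?r X \<in> measurable M ?P \<and> ?r R \<in> measurable M ?P \<and>
        ?D X \<Otimes>\<^sub>M ?D R = distr M (?P \<Otimes>\<^sub>M ?P) (\<lambda>\<omega>. (?r X \<omega>, ?r R \<omega>))"
      using XR unfolding indep_var_distribution_eq .
    then have [measurable]: "?r X \<in> measurable M ?P" "?r R \<in> measurable M ?P"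
      by blast+
    show "?r X \<in> measurable M ?P" by measurable
    interpret X: prob_space "?D X" by (rule prob_space_distr) measurable
    interpret R: prob_space "?D R" by (rule prob_space_distr) measurable
    interpret XR: pair_sigma_finite "?D X" "?D R" ..
    have "sets (?D X \<Otimes>\<^sub>M ?D R) = sets (?P \<Otimes>\<^sub>M ?P)"
      by (intro sets_pair_measure_cong) auto
    then have B': "B \<in> sets (?D X \<Otimes>\<^sub>M ?D R)"
      using B by simp
    show "(\<lambda>r. emeasure (?D X) ((\<lambda>x. (x, r)) -` B)) \<in> borel_measurable (?D R)"
      by (rule XR.measurable_emeasure_Pair2[OF B'])
    have "{\<omega>\<in>space M. \<exists>t\<in>F. (X t \<omega>)\<^sup>2 + R t \<omega> > u} = (\<lambda>\<omega>. (?r X \<omega>, ?r R \<omega>)) -` B \<inter> space M"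
      by (auto simp: B_def space_pair_measure space_PiM)
    then have "emeasure M {\<omega>\<in>space M. \<exists>t\<in>F. (X t \<omega>)\<^sup>2 + R t \<omega> > u}
        = emeasure (distr M (?P \<Otimes>\<^sub>M ?P) (\<lambda>\<omega>. (?r X \<omega>, ?r R \<omega>))) B"
      using B by (simp add: emeasure_distr)
    also have "\<dots> = emeasure (?D X \<Otimes>\<^sub>M ?D R) B"
      by (simp only: XR')
    also have "\<dots> = (\<integral>\<^sup>+r. emeasure (?D X) ((\<lambda>x. (x, r)) -` B) \<partial>?D R)"
      by (rule XR.emeasure_pair_measure_alt2[OF B'])
    finally show "emeasure M {\<omega>\<in>space M. \<exists>t\<in>F. (X t \<omega>)\<^sup>2 + R t \<omega> > u}
      = (\<integral>\<^sup>+r. emeasure (?D X) ((\<lambda>x. (x, r)) -` B) \<partial>?D R)" .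
  qed
  have "emeasure M {\<omega>\<in>space M. \<exists>t\<in>F. (V t \<omega>)\<^sup>2 + R t \<omega> > u}
      \<le> (\<integral>\<^sup>+r. 2 * emeasure (?D W) ((\<lambda>x. (x, r)) -` B) \<partial>?D R)"
    unfolding fubini(3)[OF VR]
  proof (rule nn_integral_mono)
    fix r assume "r \<in> space (?D R)"
    then have r: "r \<in> space ?P" by simp
    have "ennreal (\<P>(\<omega> in M. \<exists>t\<in>F. (V t \<omega>)\<^sup>2 + r t > u)) \<le> ennreal (2 * \<P>(\<omega> in M. \<exists>t\<in>F. (W t \<omega>)\<^sup>2 + r t > u))"
      by (intro ennreal_leI slepian_square[OF V W F VW var cov])
    then show "emeasure (?D V) ((\<lambda>x. (x, r)) -` B) \<le> 2 * emeasure (?D W) ((\<lambda>x. (x, r)) -` B)"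
      unfolding slice[OF fubini(1)[OF VR] r] slice[OF fubini(1)[OF WR] r] by (simp add: ennreal_mult)
  qed
  also have "\<dots> = 2 * emeasure M {\<omega>\<in>space M. \<exists>t\<in>F. (W t \<omega>)\<^sup>2 + R t \<omega> > u}"
    unfolding fubini(3)[OF WR] by (rule nn_integral_cmult[OF fubini(2)[OF WR]])
  also have "\<dots> = ennreal (2 * \<P>(\<omega> in M. \<exists>t\<in>F. (W t \<omega>)\<^sup>2 + R t \<omega> > u))"
    by (simp add: emeasure_eq_measure ennreal_mult)
  finally show ?thesis
    unfolding emeasure_eq_measure by (subst (asm) ennreal_le_iff) auto
qed

section \<open>From finitely many times to the supremum\<close>

text \<open>The condition that the path exceeds \<open>u\<close> is open, so on a continuous path an
  exceedance anywhere in \<open>T\<close> forces one at a point of \<open>D\<close>. Hence the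
  supremum event agrees almost everywhere with a countable union of events, which also makes it
  measurable in the completion.\<close>

lemma (in prob_space) sup_exceed_prob_eq_countable:
  fixes Z :: "'t::first_countable_topology \<Rightarrow> 'a \<Rightarrow> real"
  assumes D: "countable D" "D \<subseteq> T" "\<And>t. t \<in> T \<Longrightarrow> \<exists>x. (\<forall>n. x n \<in> D) \<and> x \<longlonglongrightarrow> t"
    and Z: "\<And>t. t \<in> D \<Longrightarrow> Z t \<in> borel_measurable M"
    and cont: "AE \<omega> in M. continuous_on T (\<lambda>t. Z t \<omega>)"
  shows "sup_exceed_prob M T Z u = \<P>(\<omega> in M. \<exists>t\<in>D. Z t \<omega> > u)"
proof -
  let ?A = "{\<omega> \<in> space M. (SUP t\<in>T. ereal (Z t \<omega>)) > ereal u}"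
  let ?B = "{\<omega> \<in> space M. \<exists>t\<in>D. Z t \<omega> > u}"
  have "?B = (\<Union>t\<in>D. {\<omega>\<in>space M. Z t \<omega> > u})" by auto
  also have "\<dots> \<in> events"
    using D(1) Z by (intro sets.countable_UN'') (auto intro!: borel_measurable_less)
  finally have B: "?B \<in> events" .
  have "AE \<omega> in M. \<omega> \<in> ?B \<longleftrightarrow> \<omega> \<in> ?A"
    using cont
  proof eventually_elim
    case (elim \<omega>)
    have "(\<exists>t\<in>T. Z t \<omega> > u) \<longleftrightarrow> (\<exists>t\<in>D. Z t \<omega> > u)"
    proof
      assume "\<exists>t\<in>T. Z t \<omega> > u"
      then obtain t where t: "t \<in> T" "Z t \<omega> > u" by blast
      obtain x where x: "\<And>n. x n \<in> D" "x \<longlonglongrightarrow> t" using D(3)[OF t(1)] by blast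
      have "(\<lambda>n. Z (x n) \<omega>) \<longlonglongrightarrow> Z t \<omega>"
        using x(1) D(2) by (intro continuous_on_tendsto_compose[OF elim x(2) t(1)] always_eventually) auto
      then have "eventually (\<lambda>n. Z (x n) \<omega> > u) sequentially"
        using t(2) by (rule order_tendstoD)
      then obtain n where "Z (x n) \<omega> > u"
        by (auto simp: eventually_sequentially)
      then show "\<exists>t\<in>D. Z t \<omega> > u" using x(1) by blast
    qed (use D(2) in blast)
    then show ?case by (simp add: less_SUP_iff)
  qed
  then have AE: "AE \<omega> in completion M. \<omega> \<in> ?B \<longleftrightarrow> \<omega> \<in> ?A"
    by (rule AE_completion)
  have B': "?B \<in> sets (completion M)" using B by simp
  have "?A \<in> sets (completion M)"
    by (rule completion.in_sets_AE[OF AE B']) auto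
  then have "measure (completion M) ?B = measure (completion M) ?A"
    by (rule measure_eq_AE[OF AE B'])
  then show ?thesis
    using B by (simp add: sup_exceed_prob_def)
qed

text \<open>Continuity from below along the finite initial segments of an enumeration of
  \<open>D\<close>. The empty set has no enumeration and is treated separately.\<close>

lemma (in prob_space) prob_bex_le_if_finite_subsets:
  assumes D: "countable D" and P: "\<And>t. t \<in> D \<Longrightarrow> {\<omega>\<in>space M. P t \<omega>} \<in> events"
    and le: "\<And>F. finite F \<Longrightarrow> F \<subseteq> D \<Longrightarrow> \<P>(\<omega> in M. \<exists>t\<in>F. P t \<omega>) \<le> C"
  shows "\<P>(\<omega> in M. \<exists>t\<in>D. P t \<omega>) \<le> C"
proof (cases "D = {}")
  case True
  then show ?thesis using le[of "{}"] by simp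
next
  case False
  let ?F = "\<lambda>n. from_nat_into D ` {..<n}"
  let ?A = "\<lambda>n. {\<omega>\<in>space M. \<exists>t\<in>?F n. P t \<omega>}"
  have sub: "?F n \<subseteq> D" for n using from_nat_into[OF False] by blast
  have "?A n = (\<Union>t\<in>?F n. {\<omega>\<in>space M. P t \<omega>})" for n by auto
  moreover have "(\<Union>t\<in>?F n. {\<omega>\<in>space M. P t \<omega>}) \<in> events" for n
    using P sub by (intro sets.finite_UN) auto
  ultimately have "range ?A \<subseteq> events" by auto
  moreover have "incseq ?A"
    by (rule incseq_SucI) auto
  ultimately have "(\<lambda>n. prob (?A n)) \<longlonglongrightarrow> prob (\<Union>n. ?A n)"
    by (rule finite_Lim_measure_incseq)
  moreover have "(\<Union>n. ?A n) = {\<omega>\<in>space M. \<exists>t\<in>D. P t \<omega>}"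
  proof -
    have "(\<Union>n. ?F n) = D"
      using range_from_nat_into[OF False D] by (auto simp: image_def)
    then show ?thesis by blast
  qed
  ultimately have "(\<lambda>n. prob (?A n)) \<longlonglongrightarrow> \<P>(\<omega> in M. \<exists>t\<in>D. P t \<omega>)"
    by (simp only:)
  moreover have "prob (?A n) \<le> C" for n
    by (rule le[OF _ sub]) simp
  ultimately show ?thesis
    by (rule LIMSEQ_le_const2[OF _ exI, OF _ allI, OF _ impI])
qed

section \<open>Replacing the processes one at a time\<close>

lemma measurable_component_component:
  assumes "i \<in> I" "t \<in> T"
  shows "(\<lambda>q. q i t) \<in> measurable (PiM I (\<lambda>_. PiM T (\<lambda>_. N))) N"
  using measurable_compose[OF measurable_component_singleton[OF assms(1), of "\<lambda>_. PiM T (\<lambda>_. N)"]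
      measurable_component_singleton[OF assms(2), of "\<lambda>_. N"]] .

text \<open>Disjoint blocks of an independent family are independent, and so are measurable
  functions of them. The parameter \<open>g\<close> lets the same fact serve for a single other
  process and for the sum of squares of all remaining ones.\<close>

lemma (in prob_space) indep_processes_indep_var:
  fixes X :: "'i \<Rightarrow> 't \<Rightarrow> 'a \<Rightarrow> real"
  assumes X: "indep_processes M T X I" and i: "i \<in> I" and J: "J \<subseteq> I" "i \<notin> J" and F: "F \<subseteq> T"
    and g: "g \<in> measurable (PiM J (\<lambda>_. PiM T (\<lambda>_. borel))) N"
  shows "indep_var (PiM F (\<lambda>_. borel)) (\<lambda>\<omega>. \<lambda>t\<in>F. X i t \<omega>) N (\<lambda>\<omega>. g (\<lambda>j\<in>J. \<lambda>t\<in>T. X j t \<omega>))"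
proof -
  have "indep_var (PiM {i} (\<lambda>_. PiM T (\<lambda>_. borel))) (\<lambda>\<omega>. \<lambda>j\<in>{i}. \<lambda>t\<in>T. X j t \<omega>)
      (PiM J (\<lambda>_. PiM T (\<lambda>_. borel))) (\<lambda>\<omega>. \<lambda>j\<in>J. \<lambda>t\<in>T. X j t \<omega>)"
    using X i J unfolding indep_processes_def by (intro indep_var_restrict) auto
  moreover have "(\<lambda>p. \<lambda>t\<in>F. p i t) \<in> measurable (PiM {i} (\<lambda>_. PiM T (\<lambda>_. borel))) (PiM F (\<lambda>_. borel :: real measure))"
  proof (rule measurable_restrict)
    fix t assume "t \<in> F"
    then have "t \<in> T" using F by blast
    then show "(\<lambda>p. p i t) \<in> borel_measurable (PiM {i} (\<lambda>_. PiM T (\<lambda>_. borel :: real measure)))"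
      by (intro measurable_component_component) auto
  qed
  ultimately have "indep_var (PiM F (\<lambda>_. borel)) ((\<lambda>p. \<lambda>t\<in>F. p i t) \<circ> (\<lambda>\<omega>. \<lambda>j\<in>{i}. \<lambda>t\<in>T. X j t \<omega>))
      N (g \<circ> (\<lambda>\<omega>. \<lambda>j\<in>J. \<lambda>t\<in>T. X j t \<omega>))"
    using g by (rule indep_var_compose)
  moreover have "(\<lambda>p. \<lambda>t\<in>F. p i t) \<circ> (\<lambda>\<omega>. \<lambda>j\<in>{i}. \<lambda>t\<in>T. X j t \<omega>) = (\<lambda>\<omega>. \<lambda>t\<in>F. X i t \<omega>)"
    using F by (auto simp: fun_eq_iff restrict_def)
  ultimately show ?thesis by (simp add: comp_def)
qed

text \<open>The hybrid \<open>Z k\<close> uses \<open>W\<close> for the first k indices and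
  \<open>V\<close> for the others. Passing from k to k + 1 changes a single summand and costs a
  factor 2, so n steps cost \<open>2 ^ n\<close>.\<close>

lemma (in prob_space) finite_chi_square_comparison:
  fixes V W :: "nat \<Rightarrow> 't \<Rightarrow> 'a \<Rightarrow> real"
  assumes indep: "indep_processes M T (case_sum V W) ({1..n} <+> {1..n})"
    and V: "\<And>i. i \<in> {1..n} \<Longrightarrow> centered_gaussian_process M T (V i)"
    and W: "\<And>i. i \<in> {1..n} \<Longrightarrow> centered_gaussian_process M T (W i)"
    and var: "\<And>i t. i \<in> {1..n} \<Longrightarrow> t \<in> T \<Longrightarrow> (\<integral>\<omega>. (V i t \<omega>)\<^sup>2 \<partial>M) = (\<integral>\<omega>. (W i t \<omega>)\<^sup>2 \<partial>M)"
    and cov: "\<And>i s t. i \<in> {1..n} \<Longrightarrow> s \<in> T \<Longrightarrow> t \<in> T \<Longrightarrow>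
      (\<integral>\<omega>. V i s \<omega> * V i t \<omega> \<partial>M) \<ge> (\<integral>\<omega>. W i s \<omega> * W i t \<omega> \<partial>M)"
    and F: "finite F" "F \<subseteq> T"
  shows "\<P>(\<omega> in M. \<exists>t\<in>F. (\<Sum>i=1..n. (V i t \<omega>)\<^sup>2) > u)
       \<le> 2 ^ n * \<P>(\<omega> in M. \<exists>t\<in>F. (\<Sum>i=1..n. (W i t \<omega>)\<^sup>2) > u)"
proof -
  define e where "e k i = (if i \<le> k then Inr i else Inl i :: nat + nat)" for k i :: nat
  define Z where "Z k i = case_sum V W (e k i)" for k i
  define p where "p k = \<P>(\<omega> in M. \<exists>t\<in>F. (\<Sum>i=1..n. (Z k i t \<omega>)\<^sup>2) > u)" for k
  have step: "p k \<le> 2 * p (Suc k)" if k: "k < n" for k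
  proof -
    define j where "j = Suc k"
    have j: "j \<in> {1..n}" using k by (simp add: j_def)
    define R where "R t \<omega> = (\<Sum>i\<in>{1..n}-{j}. (Z k i t \<omega>)\<^sup>2)" for t \<omega>
    \<comment> \<open>\<open>J\<close> lists the processes entering the common remainder
      \<open>R\<close>. It contains neither \<open>Inl j\<close> nor \<open>Inr j\<close>, so
      \<open>R\<close> is independent of the outgoing process as well as of the incoming
      one.\<close>
    define J where "J = e k ` ({1..n} - {j})"
    have mem: "Inl j \<in> {1..n} <+> {1..n}" "Inr j \<in> {1..n} <+> {1..n}"
      using j by blast+
    have J: "J \<subseteq> {1..n} <+> {1..n}" "Inl j \<notin> J" "Inr j \<notin> J"
      by (auto simp: J_def e_def split: if_splits)
    have sum: "(\<Sum>i=1..n. (Z k i t \<omega>)\<^sup>2) = (V j t \<omega>)\<^sup>2 + R t \<omega>"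
      "(\<Sum>i=1..n. (Z (Suc k) i t \<omega>)\<^sup>2) = (W j t \<omega>)\<^sup>2 + R t \<omega>" for t \<omega>
    proof -
      have "Z k j = V j" "Z (Suc k) j = W j" by (simp_all add: Z_def e_def j_def)
      moreover have "Z (Suc k) i = Z k i" if "i \<noteq> j" for i
        using that by (simp add: Z_def e_def j_def le_Suc_eq)
      ultimately show "(\<Sum>i=1..n. (Z k i t \<omega>)\<^sup>2) = (V j t \<omega>)\<^sup>2 + R t \<omega>"
        "(\<Sum>i=1..n. (Z (Suc k) i t \<omega>)\<^sup>2) = (W j t \<omega>)\<^sup>2 + R t \<omega>"
        unfolding R_def sum.remove[OF finite_atLeastAtMost j] by (auto intro!: sum.cong)
    qed
    \<comment> \<open>\<open>g\<close> exhibits \<open>R\<close> at the times in \<open>F\<close> as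
      a measurable function of the processes in \<open>J\<close>.\<close>
    define g where "g q = (\<lambda>t\<in>F. \<Sum>i\<in>{1..n}-{j}. (q (e k i) t)\<^sup>2)" for q :: "nat + nat \<Rightarrow> 't \<Rightarrow> real"
    have g: "g \<in> measurable (PiM J (\<lambda>_. PiM T (\<lambda>_. borel))) (PiM F (\<lambda>_. borel))"
      unfolding g_def
    proof (intro measurable_restrict borel_measurable_sum borel_measurable_power)
      fix t i assume "t \<in> F" "i \<in> {1..n} - {j}"
      then have "t \<in> T" "e k i \<in> J" using F by (auto simp: J_def)
      then show "(\<lambda>q. q (e k i) t) \<in> borel_measurable (PiM J (\<lambda>_. PiM T (\<lambda>_. borel :: real measure)))"
        by (intro measurable_component_component) auto
    qed
    have gR: "g (\<lambda>j\<in>J. \<lambda>t\<in>T. case_sum V W j t \<omega>) = (\<lambda>t\<in>F. R t \<omega>)" for \<omega>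
      using F by (auto simp: g_def R_def Z_def J_def fun_eq_iff restrict_def intro!: sum.cong)
    have VR: "indep_var (PiM F (\<lambda>_. borel)) (\<lambda>\<omega>. \<lambda>t\<in>F. V j t \<omega>) (PiM F (\<lambda>_. borel)) (\<lambda>\<omega>. \<lambda>t\<in>F. R t \<omega>)"
      using indep_processes_indep_var[OF indep mem(1) J(1,2) F(2) g] unfolding gR by simp
    have WR: "indep_var (PiM F (\<lambda>_. borel)) (\<lambda>\<omega>. \<lambda>t\<in>F. W j t \<omega>) (PiM F (\<lambda>_. borel)) (\<lambda>\<omega>. \<lambda>t\<in>F. R t \<omega>)"
      using indep_processes_indep_var[OF indep mem(2) J(1,3) F(2) g] unfolding gR by simp
    have h: "(\<lambda>q. \<lambda>t\<in>F. q (Inr j) t) \<in> measurable (PiM {Inr j} (\<lambda>_. PiM T (\<lambda>_. borel))) (PiM F (\<lambda>_. borel :: real measure))"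
    proof (rule measurable_restrict)
      fix t assume "t \<in> F"
      then have "t \<in> T" using F by blast
      then show "(\<lambda>q. q (Inr j) t) \<in> borel_measurable (PiM {Inr j} (\<lambda>_. PiM T (\<lambda>_. borel :: real measure)))"
        by (intro measurable_component_component) auto
    qed
    have hW: "(\<lambda>t\<in>F. (\<lambda>j\<in>{Inr j}. \<lambda>t\<in>T. case_sum V W j t \<omega>) (Inr j) t) = (\<lambda>t\<in>F. W j t \<omega>)" for \<omega>
      using F by (auto simp: fun_eq_iff restrict_def)
    have VW: "indep_var (PiM F (\<lambda>_. borel)) (\<lambda>\<omega>. \<lambda>t\<in>F. V j t \<omega>) (PiM F (\<lambda>_. borel)) (\<lambda>\<omega>. \<lambda>t\<in>F. W j t \<omega>)"
      using indep_processes_indep_var[OF indep mem(1) _ _ F(2) h] mem(2) unfolding hW by simp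
    show ?thesis
      unfolding p_def sum
      using F(2) j by (intro slepian_square_plus_indep[OF V W F VW VR WR]) (auto intro!: var cov)
  qed
  have "p 0 \<le> 2 ^ k * p k" if "k \<le> n" for k
    using that
  proof (induction k)
    case (Suc k)
    then have "p 0 \<le> 2 ^ k * p k" by simp
    also have "\<dots> \<le> 2 ^ k * (2 * p (Suc k))"
      using step[of k] Suc.prems by (intro mult_left_mono) auto
    finally show ?case by simp
  qed simp
  then have "p 0 \<le> 2 ^ n * p n" by simp
  moreover have "p 0 = \<P>(\<omega> in M. \<exists>t\<in>F. (\<Sum>i=1..n. (V i t \<omega>)\<^sup>2) > u)"
    unfolding p_def Z_def e_def by (intro arg_cong[of _ _ prob] Collect_cong conj_cong bex_cong refl arg_cong[of _ _ "\<lambda>x. u < x"] sum.cong) auto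
  moreover have "p n = \<P>(\<omega> in M. \<exists>t\<in>F. (\<Sum>i=1..n. (W i t \<omega>)\<^sup>2) > u)"
    unfolding p_def Z_def e_def by (intro arg_cong[of _ _ prob] Collect_cong conj_cong bex_cong refl arg_cong[of _ _ "\<lambda>x. u < x"] sum.cong) auto
  ultimately show ?thesis by simp
qed

theorem lemma4p2:
  fixes M :: "'a measure"
    and V W :: "nat \<Rightarrow> real \<Rightarrow> 'a \<Rightarrow> real"
    and c d u :: real and n :: nat
  assumes "prob_space M"
    and "c \<le> d"
    and "n \<ge> 1"
    and "indep_processes M {c..d} (case_sum V W) ({1..n} <+> {1..n})"
    and "\<And>i. i \<in> {1..n} \<Longrightarrow> centered_gaussian_process M {c..d} (V i)"
    and "\<And>i. i \<in> {1..n} \<Longrightarrow> centered_gaussian_process M {c..d} (W i)"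
    and "\<And>i. i \<in> {1..n} \<Longrightarrow> continuous_paths_ae M {c..d} (V i)"
    and "\<And>i. i \<in> {1..n} \<Longrightarrow> continuous_paths_ae M {c..d} (W i)"
    and "\<And>i t. i \<in> {1..n} \<Longrightarrow> t \<in> {c..d} \<Longrightarrow>
           (\<integral>\<omega>. (V i t \<omega>)\<^sup>2 \<partial>M) = (\<integral>\<omega>. (W i t \<omega>)\<^sup>2 \<partial>M)"
    and "\<And>i s t. i \<in> {1..n} \<Longrightarrow> s \<in> {c..d} \<Longrightarrow> t \<in> {c..d} \<Longrightarrow>
           (\<integral>\<omega>. V i s \<omega> * V i t \<omega> \<partial>M) \<ge> (\<integral>\<omega>. W i s \<omega> * W i t \<omega> \<partial>M)"
    and "u > 0"
  shows "sup_exceed_prob M {c..d} (\<lambda>t \<omega>. \<Sum>i=1..n. (V i t \<omega>)\<^sup>2) u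
       \<le> 2 ^ n * sup_exceed_prob M {c..d} (\<lambda>t \<omega>. \<Sum>i=1..n. (W i t \<omega>)\<^sup>2) u"
proof -
  interpret prob_space M by fact
  let ?V = "\<lambda>t \<omega>. \<Sum>i=1..n. (V i t \<omega>)\<^sup>2" and ?W = "\<lambda>t \<omega>. \<Sum>i=1..n. (W i t \<omega>)\<^sup>2"
  \<comment> \<open>Continuity of the paths reduces the supremum to a countable dense set of times,
    and continuity from below reduces that set to its finite subsets.\<close>
  obtain D where D: "countable D" "D \<subseteq> {c..d}" "{c..d} \<subseteq> closure D"
    by (rule separable)
  have dense: "\<exists>x. (\<forall>n. x n \<in> D) \<and> x \<longlonglongrightarrow> t" if "t \<in> {c..d}" for t
    using D(3) that closure_sequential by blast
  have meas: "?V t \<in> borel_measurable M" "?W t \<in> borel_measurable M" if "t \<in> {c..d}" for t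
    using that assms(5,6) centered_gaussian_processD(4)[of M "{c..d}" _ "{}" t]
    by (auto intro!: borel_measurable_sum borel_measurable_power)
  have cont: "AE \<omega> in M. continuous_on {c..d} (\<lambda>t. \<Sum>i=1..n. (X i t \<omega>)\<^sup>2)"
    if "\<And>i. i \<in> {1..n} \<Longrightarrow> continuous_paths_ae M {c..d} (X i)" for X
  proof -
    have "AE \<omega> in M. \<forall>i\<in>{1..n}. continuous_on {c..d} (\<lambda>t. X i t \<omega>)"
      using that by (intro AE_finite_allI) (auto simp: continuous_paths_ae_def)
    then show ?thesis
      by eventually_elim (intro continuous_intros, blast)
  qed
  have sup_V: "sup_exceed_prob M {c..d} ?V u = \<P>(\<omega> in M. \<exists>t\<in>D. ?V t \<omega> > u)"
    using D(2) by (intro sup_exceed_prob_eq_countable D(1,2) dense cont assms(7) meas) auto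
  have sup_W: "sup_exceed_prob M {c..d} ?W u = \<P>(\<omega> in M. \<exists>t\<in>D. ?W t \<omega> > u)"
    using D(2) by (intro sup_exceed_prob_eq_countable D(1,2) dense cont assms(8) meas) auto
  have events: "{\<omega>\<in>space M. ?V t \<omega> > u} \<in> events" "{\<omega>\<in>space M. ?W t \<omega> > u} \<in> events" if "t \<in> D" for t
    using meas[of t] that D(2) by (auto intro!: borel_measurable_less)
  have "\<P>(\<omega> in M. \<exists>t\<in>D. ?V t \<omega> > u) \<le> 2 ^ n * \<P>(\<omega> in M. \<exists>t\<in>D. ?W t \<omega> > u)"
  proof (rule prob_bex_le_if_finite_subsets[OF D(1) events(1)])
    fix F assume F: "finite F" "F \<subseteq> D"
    then have "\<P>(\<omega> in M. \<exists>t\<in>F. ?V t \<omega> > u) \<le> 2 ^ n * \<P>(\<omega> in M. \<exists>t\<in>F. ?W t \<omega> > u)"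
      using D(2) assms(5,6,9,10) by (intro finite_chi_square_comparison[OF assms(4)]) auto
    \<comment> \<open>The bound must not depend on the finite set \<open>F\<close>, so on the
      \<open>W\<close> side \<open>F\<close> is enlarged to \<open>D\<close>.\<close>
    also have "\<dots> \<le> 2 ^ n * \<P>(\<omega> in M. \<exists>t\<in>D. ?W t \<omega> > u)"
    proof (intro mult_left_mono finite_measure_mono)
      have "{\<omega>\<in>space M. \<exists>t\<in>D. ?W t \<omega> > u} = (\<Union>t\<in>D. {\<omega>\<in>space M. ?W t \<omega> > u})" by auto
      also have "\<dots> \<in> events"
        using D(1) events(2) by (intro sets.countable_UN'') auto
      finally show "{\<omega>\<in>space M. \<exists>t\<in>D. ?W t \<omega> > u} \<in> events" .
    qed (use F in auto)
    finally show "\<P>(\<omega> in M. \<exists>t\<in>F. ?V t \<omega> > u) \<le> 2 ^ n * \<P>(\<omega> in M. \<exists>t\<in>D. ?W t \<omega> > u)" .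
  qed
  then show ?thesis unfolding sup_V sup_W .
qed

end
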